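(* For every real number $C\ge 8$ and every integer $n\ge 9C$, every $n$-vertex $C$-expander is $\lfloor C/8\rfloor$-rigid.
   Context: All graphs are finite and simple. $C$-expanders: for a graph $G=(V,E)$ and $A\subseteq V$, let $N(A)$ denote the external neighbourhood of $A$, i.e. the set of vertices in $V\setminus A$ having at least one neighbour in $A$. For a real $C>0$, an $n$-vertex graph $G=(V,E)$ is a $C$-expander if (i) for every $A\subseteq V$ with $|A|<n/(2C)$ we have $|N(A)|\ge C|A|$; and (ii) there is an edge between any two disjoint sets $A,B\subseteq V$ with $|A|,|B|\ge n/(2C)$. Rigidity: a $d$-dimensional framework is a pair $(G,\mathbf{p})$ where $G=(V,E)$ is a graph and $\mathbf{p}:V\to\mathbb{R}^d$. It is rigid if every continuous motion of the vertices starting at $\mathbf{p}$ that preserves the lengths of all edges preserves the distances between all pairs of vertices. The map $\mathbf{p}$ is generic if the $d|V|$ coordinates of the points $\mathbf{p}(v)$, $v\in V$, are algebraically independent over $\mathbb{Q}$. For $d\ge 1$, $G$ is $d$-rigid if $(G,\mathbf{p})$ is rigid for a generic $\mathbf{p}:V\to\mathbb{R}^d$ (this does not depend on the choice of generic $\mathbf{p}$). By convention every graph is $0$-rigid. *)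

theory Defs
  imports "HOL-Analysis.Analysis" "HOL-Library.Poly_Mapping" "Graph_Theory.Pair_Digraph"
begin

text \<open>
  Finite simple graphs are the \<^locale>\<open>pair_graph\<close>s of the library: finite, loop-free digraphs
  with a symmetric arc relation \<^const>\<open>parcs\<close>, so \<open>(u, v) \<in> parcs G\<close> says that
  \<open>u\<close> and \<open>v\<close> are adjacent.
\<close>

definition ext_nbhd :: "'a pair_pre_digraph \<Rightarrow> 'a set \<Rightarrow> 'a set" where
  "ext_nbhd G A = {v \<in> pverts G - A. \<exists>u\<in>A. (u, v) \<in> parcs G}"

definition expander :: "real \<Rightarrow> 'a pair_pre_digraph \<Rightarrow> bool" where
  "expander C G \<longleftrightarrow>
     (\<forall>A \<subseteq> pverts G. real (card A) < real (card (pverts G)) / (2 * C) \<longrightarrow>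
        real (card (ext_nbhd G A)) \<ge> C * real (card A)) \<and>
     (\<forall>A B. A \<subseteq> pverts G \<longrightarrow> B \<subseteq> pverts G \<longrightarrow> A \<inter> B = {} \<longrightarrow>
        real (card A) \<ge> real (card (pverts G)) / (2 * C) \<longrightarrow>
        real (card B) \<ge> real (card (pverts G)) / (2 * C) \<longrightarrow>
        (\<exists>a\<in>A. \<exists>b\<in>B. (a, b) \<in> parcs G))"

text \<open>
  A multivariate polynomial over \<open>\<rat>\<close> with variables indexed by \<open>'i\<close> is a finitely supported map
  from monomials to coefficients, a monomial being a finitely supported exponent map.
\<close>

type_synonym 'i rat_mpoly = "('i \<Rightarrow>\<^sub>0 nat) \<Rightarrow>\<^sub>0 rat"

definition mpoly_eval :: "('i \<Rightarrow> real) \<Rightarrow> 'i rat_mpoly \<Rightarrow> real" where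
  "mpoly_eval x q =
     (\<Sum>m\<in>Poly_Mapping.keys q. of_rat (Poly_Mapping.lookup q m) *
        (\<Prod>i\<in>Poly_Mapping.keys m. x i ^ Poly_Mapping.lookup m i))"

definition alg_independent :: "'i set \<Rightarrow> ('i \<Rightarrow> real) \<Rightarrow> bool" where
  "alg_independent I x \<longleftrightarrow>
     (\<forall>q :: 'i rat_mpoly. (\<forall>m \<in> Poly_Mapping.keys q. Poly_Mapping.keys m \<subseteq> I) \<longrightarrow>
        mpoly_eval x q = 0 \<longrightarrow> q = 0)"

text \<open>
  Since the dimension \<open>d\<close> is a variable, points of \<open>\<real>\<^sup>d\<close> are functions \<open>nat \<Rightarrow> real\<close> of which only
  the coordinates below \<open>d\<close> matter. Likewise only the values of a placement \<open>p\<close> on the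
  vertex set matter.
\<close>

definition edist :: "nat \<Rightarrow> (nat \<Rightarrow> real) \<Rightarrow> (nat \<Rightarrow> real) \<Rightarrow> real" where
  "edist d x y = L2_set (\<lambda>i. x i - y i) {..<d}"

definition generic :: "nat \<Rightarrow> 'a set \<Rightarrow> ('a \<Rightarrow> nat \<Rightarrow> real) \<Rightarrow> bool" where
  "generic d V p \<longleftrightarrow> alg_independent (V \<times> {..<d}) (\<lambda>(v, i). p v i)"

text \<open>Motions are parametrised by time in \<open>[0, 1]\<close>.\<close>

definition motion :: "nat \<Rightarrow> 'a set \<Rightarrow> ('a \<Rightarrow> nat \<Rightarrow> real) \<Rightarrow> (real \<Rightarrow> 'a \<Rightarrow> nat \<Rightarrow> real) \<Rightarrow> bool" where
  "motion d V p \<gamma> \<longleftrightarrow>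
     (\<forall>v\<in>V. \<forall>i<d. continuous_on {0..1} (\<lambda>t. \<gamma> t v i) \<and> \<gamma> 0 v i = p v i)"

definition rigid_framework :: "nat \<Rightarrow> 'a pair_pre_digraph \<Rightarrow> ('a \<Rightarrow> nat \<Rightarrow> real) \<Rightarrow> bool" where
  "rigid_framework d G p \<longleftrightarrow>
     (\<forall>\<gamma>. motion d (pverts G) p \<gamma> \<longrightarrow>
        (\<forall>t\<in>{0..1}. \<forall>(u, v)\<in>parcs G. edist d (\<gamma> t u) (\<gamma> t v) = edist d (p u) (p v)) \<longrightarrow>
        (\<forall>t\<in>{0..1}. \<forall>u\<in>pverts G. \<forall>v\<in>pverts G.
           edist d (\<gamma> t u) (\<gamma> t v) = edist d (p u) (p v)))"

text \<open>
  Generic placements of a finite vertex set exist in every dimension, and whether one of them is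
  rigid does not depend on the choice, so quantifying over all of them is the same as picking one.
\<close>

definition d_rigid :: "nat \<Rightarrow> 'a pair_pre_digraph \<Rightarrow> bool" where
  "d_rigid d G \<longleftrightarrow>
     d = 0 \<or> (\<forall>p. generic d (pverts G) p \<longrightarrow> rigid_framework d G p)"

end

theory Submission
  imports Defs "Jordan_Normal_Form.Determinant"
begin

text \<open>
  Let \<open>d = \<lfloor>C / 8\<rfloor>\<close> and \<open>\<kappa> = n / (2 C)\<close>, so that \<open>n \<ge> 16 d \<kappa>\<close>. Split the vertices into \<open>2 d\<close> colour
  classes of at least \<open>7 \<kappa>\<close> vertices and place all vertices of colour \<open>i\<close> at the same point \<open>P\<^sub>i\<close> of
  the moment curve. Since any two disjoint sets of size \<open>\<kappa>\<close> are joined by an edge, all but \<open>\<kappa>\<close> vertices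
  of either class lie in a single component of the bipartite graph between the colours \<open>i\<close> and \<open>j\<close>,
  and an infinitesimal motion \<open>u\<close> has constant component in direction \<open>P\<^sub>i - P\<^sub>j\<close> on it. By double
  counting, after discarding fewer than \<open>2 \<kappa>\<close> vertices per class, every remaining vertex lies in the
  giant components towards at least \<open>d\<close> other colours, and the vertices missing fewer than \<open>d / 2\<close>
  colours meet every giant component. The latter vertices of one class agree pairwise on \<open>d\<close>
  directions, so they move alike; the motion is then a motion of the complete framework on the
  \<open>P\<^sub>i\<close>, hence trivial. The resulting core is infinitesimally rigid at every generic placement,
  because the relevant determinant is a polynomial that does not vanish at the clustered placement.
  The core has at least \<open>10 d \<kappa>\<close> vertices, and then expansion lets the remaining vertices be attached one by
  one, each with \<open>d\<close> neighbours.

  Generic infinitesimal rigidity gives rigidity along continuous motions: the difference of two placements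
  with the same edge lengths is an infinitesimal motion of their midpoint, and the infinitesimal motions
  of placements near a congruent copy of a generic one are controlled by Gram determinants of edge
  rows, which depend on distances only.
\<close>

section \<open>Linear algebra over finite index sets\<close>

definition ip :: "'i set \<Rightarrow> ('i \<Rightarrow> real) \<Rightarrow> ('i \<Rightarrow> real) \<Rightarrow> real" where
  "ip I u w = (\<Sum>x\<in>I. u x * w x)"

lemma ip_commute: "ip I u w = ip I w u"
  by (simp add: ip_def mult.commute)

lemma ip_diff_right: "ip I u (\<lambda>x. v x - w x) = ip I u v - ip I u w"
  by (simp add: ip_def algebra_simps sum_subtractf)

lemma ip_sum_right: "ip I u (\<lambda>x. \<Sum>k\<in>K. c k * r k x) = (\<Sum>k\<in>K. c k * ip I u (r k))"
  unfolding ip_def by (simp add: sum_distrib_left mult.left_commute sum.swap[of _ K I])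

lemma ip_sum_left: "ip I (\<lambda>x. \<Sum>k\<in>K. c k * r k x) u = (\<Sum>k\<in>K. c k * ip I (r k) u)"
  using ip_sum_right ip_commute by (metis (mono_tags, lifting) sum.cong)

lemma ip_self_eq_0_iff:
  assumes "finite I"
  shows "ip I u u = 0 \<longleftrightarrow> (\<forall>x\<in>I. u x = 0)"
  using assms by (simp add: ip_def sum_nonneg_eq_0_iff)

section \<open>Determinants of matrices indexed by arbitrary finite sets\<close>

definition enum_of :: "'i set \<Rightarrow> nat \<Rightarrow> 'i" where
  "enum_of I = (SOME h. bij_betw h {0..<card I} I)"

lemma enum_of:
  assumes "finite I"
  shows "bij_betw (enum_of I) {0..<card I} I"
  unfolding enum_of_def using someI_ex[OF ex_bij_betw_nat_finite[OF assms]] .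

text \<open>Rows and columns share one enumeration, so the determinant is independent of which
  enumeration is chosen.\<close>

definition gmat :: "'i set \<Rightarrow> ('i \<Rightarrow> 'i \<Rightarrow> real) \<Rightarrow> real mat" where
  "gmat I a = mat (card I) (card I) (\<lambda>(i, j). a (enum_of I i) (enum_of I j))"

definition gdet :: "'i set \<Rightarrow> ('i \<Rightarrow> 'i \<Rightarrow> real) \<Rightarrow> real" where
  "gdet I a = det (gmat I a)"

lemma gdet_expand:
  "gdet I a = (\<Sum>\<pi> | \<pi> permutes {0..<card I}.
     signof \<pi> * (\<Prod>i = 0..<card I. a (enum_of I i) (enum_of I (\<pi> i))))"
proof -
  have "(\<Prod>i = 0..<card I. gmat I a $$ (i, \<pi> i)) = (\<Prod>i = 0..<card I. a (enum_of I i) (enum_of I (\<pi> i)))"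
    if "\<pi> permutes {0..<card I}" for \<pi>
    by (rule prod.cong) (use that permutes_in_image[OF that] in \<open>auto simp: gmat_def\<close>)
  then show ?thesis
    unfolding gdet_def by (subst det_def'[of _ "card I"]) (auto simp: gmat_def)
qed

lemma gdet_cong:
  assumes "finite I" "\<And>x y. x \<in> I \<Longrightarrow> y \<in> I \<Longrightarrow> a x y = b x y"
  shows "gdet I a = gdet I b"
proof -
  have "enum_of I i \<in> I" if "i < card I" for i
    using enum_of[OF assms(1)] that by (auto simp: bij_betw_def)
  then have "gmat I a = gmat I b"
    unfolding gmat_def by (intro eq_matI) (auto intro!: assms(2))
  then show ?thesis by (simp add: gdet_def)
qed

lemma gmat_mult_vec:
  assumes "finite I" "i < card I"
  shows "(gmat I a *\<^sub>v vec (card I) (\<lambda>j. x (enum_of I j))) $ i = (\<Sum>y\<in>I. a (enum_of I i) y * x y)"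
proof -
  have "(gmat I a *\<^sub>v vec (card I) (\<lambda>j. x (enum_of I j))) $ i
      = (\<Sum>j = 0..<card I. a (enum_of I i) (enum_of I j) * x (enum_of I j))"
    using assms by (simp add: gmat_def scalar_prod_def)
  also have "\<dots> = (\<Sum>y\<in>I. a (enum_of I i) y * x y)"
    by (rule sum.reindex_bij_betw[OF enum_of[OF assms(1)]])
  finally show ?thesis .
qed

lemma vec_of_enum:
  assumes "finite I" "v \<in> carrier_vec (card I)"
  obtains x where "v = vec (card I) (\<lambda>j. x (enum_of I j))"
proof
  let ?x = "\<lambda>y. v $ (the_inv_into {0..<card I} (enum_of I) y)"
  show "v = vec (card I) (\<lambda>j. ?x (enum_of I j))"
    using assms enum_of[OF assms(1)]
    by (intro eq_vecI) (auto simp: the_inv_into_f_f bij_betw_def)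
qed

lemma gdet_eq_0_iff:
  assumes "finite I"
  shows "gdet I a = 0 \<longleftrightarrow> (\<exists>x. (\<exists>i\<in>I. x i \<noteq> 0) \<and> (\<forall>i\<in>I. (\<Sum>j\<in>I. a i j * x j) = 0))"
    (is "?L \<longleftrightarrow> ?R")
proof -
  let ?n = "card I" and ?h = "enum_of I"
  have bij: "bij_betw ?h {0..<?n} I" by (rule enum_of[OF assms])
  have A: "gmat I a \<in> carrier_mat ?n ?n" by (simp add: gmat_def)
  have img: "I = ?h ` {0..<?n}" using bij by (simp add: bij_betw_def)
  have key: "gmat I a *\<^sub>v vec ?n (\<lambda>j. x (?h j)) = 0\<^sub>v ?n \<longleftrightarrow> (\<forall>i\<in>I. (\<Sum>j\<in>I. a i j * x j) = 0)" for x
  proof -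
    have "gmat I a *\<^sub>v vec ?n (\<lambda>j. x (?h j)) = 0\<^sub>v ?n \<longleftrightarrow>
       (\<forall>i<?n. (gmat I a *\<^sub>v vec ?n (\<lambda>j. x (?h j))) $ i = 0)"
      using A by (auto simp: vec_eq_iff simp del: index_mult_mat_vec)
    also have "\<dots> \<longleftrightarrow> (\<forall>i<?n. (\<Sum>y\<in>I. a (?h i) y * x y) = 0)"
      using gmat_mult_vec[OF assms] by auto
    also have "\<dots> \<longleftrightarrow> (\<forall>i\<in>?h ` {0..<?n}. (\<Sum>j\<in>I. a i j * x j) = 0)" by auto
    finally show ?thesis using img by simp
  qed
  have nz: "vec ?n (\<lambda>j. x (?h j)) \<noteq> 0\<^sub>v ?n \<longleftrightarrow> (\<exists>i\<in>I. x i \<noteq> 0)" for x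
  proof -
    have "vec ?n (\<lambda>j. x (?h j)) \<noteq> 0\<^sub>v ?n \<longleftrightarrow> (\<exists>i\<in>?h ` {0..<?n}. x i \<noteq> 0)" by (auto simp: vec_eq_iff)
    then show ?thesis using img by simp
  qed
  have "?L \<longleftrightarrow> (\<exists>v. v \<in> carrier_vec ?n \<and> v \<noteq> 0\<^sub>v ?n \<and> gmat I a *\<^sub>v v = 0\<^sub>v ?n)"
    unfolding gdet_def by (rule det_0_iff_vec_prod_zero_field[OF A])
  also have "\<dots> \<longleftrightarrow> ?R"
  proof
    assume "\<exists>v. v \<in> carrier_vec ?n \<and> v \<noteq> 0\<^sub>v ?n \<and> gmat I a *\<^sub>v v = 0\<^sub>v ?n"
    then obtain v where v: "v \<in> carrier_vec ?n" "v \<noteq> 0\<^sub>v ?n" "gmat I a *\<^sub>v v = 0\<^sub>v ?n" by blast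
    obtain x where "v = vec ?n (\<lambda>j. x (?h j))" using vec_of_enum[OF assms v(1)] .
    then show ?R using v key nz by blast
  next
    assume ?R
    then show "\<exists>v. v \<in> carrier_vec ?n \<and> v \<noteq> 0\<^sub>v ?n \<and> gmat I a *\<^sub>v v = 0\<^sub>v ?n"
      using key nz by (metis vec_carrier)
  qed
  finally show ?thesis .
qed

lemma gdet_solve:
  assumes "finite I" "gdet I a \<noteq> 0"
  shows "\<exists>x. \<forall>i\<in>I. (\<Sum>j\<in>I. a i j * x j) = b i"
proof -
  let ?n = "card I" and ?h = "enum_of I"
  have A: "gmat I a \<in> carrier_mat ?n ?n" by (simp add: gmat_def)
  obtain B where B: "gmat I a * B = 1\<^sub>m ?n" "B \<in> carrier_mat ?n ?n"
    using det_non_zero_imp_unit[OF A assms(2)[unfolded gdet_def], of "()"]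
    unfolding Units_def ring_mat_def by auto
  let ?b = "vec ?n (\<lambda>j. b (?h j))"
  have Bb: "B *\<^sub>v ?b \<in> carrier_vec ?n" using B by auto
  obtain x where x: "B *\<^sub>v ?b = vec ?n (\<lambda>j. x (?h j))" using vec_of_enum[OF assms(1) Bb] .
  have "gmat I a *\<^sub>v (B *\<^sub>v ?b) = ?b"
    using A B by (simp flip: assoc_mult_mat_vec)
  then have "(\<Sum>y\<in>I. a (?h i) y * x y) = b (?h i)" if "i < ?n" for i
    using gmat_mult_vec[OF assms(1) that, of a x] that unfolding x by simp
  moreover have "\<exists>k<?n. i = ?h k" if "i \<in> I" for i
    using enum_of[OF assms(1)] that unfolding bij_betw_def
    by (metis atLeastLessThan_iff imageE)
  ultimately have "(\<Sum>j\<in>I. a i j * x j) = b i" if "i \<in> I" for i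
    using that by blast
  then show ?thesis by (intro exI[of _ x]) simp
qed

section \<open>Gram determinants and row bases\<close>

definition gram :: "'i set \<Rightarrow> ('e \<Rightarrow> 'i \<Rightarrow> real) \<Rightarrow> 'e set \<Rightarrow> real" where
  "gram I r F = gdet F (\<lambda>e f. ip I (r e) (r f))"

text \<open>For \<open>c\<close> in the kernel of the Gram matrix, the combination of the rows with
  coefficients \<open>c\<close> is orthogonal to every row, hence to itself, so it vanishes. Linear
  independence of rows thus becomes the non-vanishing of a single polynomial expression in
  them.\<close>

lemma gram_eq_0_iff:
  assumes "finite I" "finite F"
  shows "gram I r F = 0 \<longleftrightarrow> (\<exists>c. (\<exists>e\<in>F. c e \<noteq> 0) \<and> (\<forall>x\<in>I. (\<Sum>e\<in>F. c e * r e x) = 0))"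
proof -
  have "(\<forall>e\<in>F. (\<Sum>f\<in>F. ip I (r e) (r f) * c f) = 0) \<longleftrightarrow> (\<forall>x\<in>I. (\<Sum>e\<in>F. c e * r e x) = 0)" for c
  proof -
    let ?s = "\<lambda>x. \<Sum>e\<in>F. c e * r e x"
    have eq: "(\<Sum>f\<in>F. ip I (r e) (r f) * c f) = ip I (r e) ?s" for e
      by (simp add: ip_sum_right mult.commute)
    show ?thesis
    proof
      assume "\<forall>e\<in>F. (\<Sum>f\<in>F. ip I (r e) (r f) * c f) = 0"
      then have "ip I ?s ?s = 0" unfolding eq by (subst ip_sum_left) simp
      then show "\<forall>x\<in>I. ?s x = 0" using ip_self_eq_0_iff[OF assms(1), of ?s] by simp
    next
      assume "\<forall>x\<in>I. ?s x = 0"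
      then show "\<forall>e\<in>F. (\<Sum>f\<in>F. ip I (r e) (r f) * c f) = 0"
        unfolding eq by (simp add: ip_def)
    qed
  qed
  then show ?thesis unfolding gram_def gdet_eq_0_iff[OF assms(2)] by simp
qed

lemma gram_solve:
  assumes "finite F" "gram I r F \<noteq> 0"
  shows "\<exists>c. \<forall>e\<in>F. ip I (r e) (\<lambda>x. \<Sum>f\<in>F. c f * r f x) = b e"
  using gdet_solve[OF assms(1) assms(2)[unfolded gram_def], of b]
  by (simp add: ip_sum_right mult.commute)

text \<open>In a dependence among the rows of \<open>insert e F\<close> the coefficient of
  \<open>e\<close> is nonzero, since \<open>F\<close> is independent. So row \<open>e\<close> lies
  in the span of \<open>F\<close> and inherits orthogonality from it.\<close>

lemma gram_insert_dependent:
  assumes "finite I" "finite F" "gram I r F \<noteq> 0" "gram I r (insert e F) = 0"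
    and "\<And>f. f \<in> F \<Longrightarrow> ip I (r f) u = 0"
  shows "ip I (r e) u = 0"
proof (cases "e \<in> F")
  case False
  obtain c where c: "\<exists>f\<in>insert e F. c f \<noteq> 0" "\<forall>x\<in>I. (\<Sum>f\<in>insert e F. c f * r f x) = 0"
    using assms(4) gram_eq_0_iff[of I "insert e F" r] assms(1,2) by auto
  have ce: "c e \<noteq> 0"
  proof
    assume 0: "c e = 0"
    then have "\<exists>f\<in>F. c f \<noteq> 0" "\<forall>x\<in>I. (\<Sum>f\<in>F. c f * r f x) = 0"
      using c False assms(2) by auto
    then show False using assms(1-3) gram_eq_0_iff by blast
  qed
  have "0 = ip I (\<lambda>x. \<Sum>f\<in>insert e F. c f * r f x) u" using c(2) by (simp add: ip_def)
  also have "\<dots> = c e * ip I (r e) u + (\<Sum>f\<in>F. c f * ip I (r f) u)"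
    by (subst ip_sum_left) (use False assms(2) in simp)
  also have "(\<Sum>f\<in>F. c f * ip I (r f) u) = 0" using assms(5) by simp
  finally show ?thesis using ce by simp
qed (use assms(5) in blast)

lemma gram_empty [simp]: "gram I r {} = 1"
  by (simp add: gram_def gdet_expand permutes_empty sign_id)

text \<open>A maximal independent set of rows; the empty set, with Gram determinant 1, starts the
  search.\<close>

lemma gram_basis:
  assumes "finite I" "finite E"
  obtains F where "F \<subseteq> E" "gram I r F \<noteq> 0" "\<And>e. e \<in> E \<Longrightarrow> e \<notin> F \<Longrightarrow> gram I r (insert e F) = 0"
proof -
  define A where "A = {F \<in> Pow E. gram I r F \<noteq> 0}"
  have fin: "finite A" using assms(2) by (simp add: A_def)
  have "{} \<in> A" by (simp add: A_def)
  then obtain F where F: "F \<in> A" "\<forall>F'\<in>A. F \<subseteq> F' \<longrightarrow> F = F'"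
    using finite_has_maximal2[OF fin] by metis
  show ?thesis
  proof (rule that)
    show "gram I r (insert e F) = 0" if "e \<in> E" "e \<notin> F" for e
    proof (rule ccontr)
      assume "gram I r (insert e F) \<noteq> 0"
      then have "insert e F \<in> A" using F(1) that(1) by (simp add: A_def)
      then have "F = insert e F" using F(2) by (simp add: subset_insertI)
      then show False using that(2) by (metis insertI1)
    qed
  qed (use F(1) in \<open>simp_all add: A_def\<close>)
qed

text \<open>The coefficients \<open>c\<close> give the orthogonal projection of \<open>u\<close>
  onto the span of the rows. They are found on a row basis and set to 0 outside it, because the full
  Gram matrix may be singular.\<close>

lemma orthogonal_decomposition:
  assumes "finite I" "finite K"
  obtains c where "\<And>k. k \<in> K \<Longrightarrow> ip I (r k) (\<lambda>x. u x - (\<Sum>j\<in>K. c j * r j x)) = 0"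
proof -
  obtain F where F: "F \<subseteq> K" "gram I r F \<noteq> 0" "\<And>e. e \<in> K \<Longrightarrow> e \<notin> F \<Longrightarrow> gram I r (insert e F) = 0"
    using gram_basis[OF assms, of r] by blast
  have fF: "finite F" using F(1) assms(2) finite_subset by blast
  obtain c where c: "\<forall>e\<in>F. ip I (r e) (\<lambda>x. \<Sum>f\<in>F. c f * r f x) = ip I (r e) u"
    using gram_solve[OF fF F(2), of "\<lambda>e. ip I (r e) u"] by blast
  let ?c = "\<lambda>k. if k \<in> F then c k else 0"
  have s: "(\<Sum>j\<in>K. ?c j * r j x) = (\<Sum>f\<in>F. c f * r f x)" for x
    by (rule sum.mono_neutral_cong_right) (use F(1) assms(2) in auto)
  have F0: "ip I (r k) (\<lambda>x. u x - (\<Sum>j\<in>K. ?c j * r j x)) = 0" if "k \<in> F" for k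
    unfolding s ip_diff_right using c that by simp
  show ?thesis
  proof (rule that)
    show "ip I (r k) (\<lambda>x. u x - (\<Sum>j\<in>K. ?c j * r j x)) = 0" if "k \<in> K" for k
      using F0 F(3)[OF that] gram_insert_dependent[OF assms(1) fF F(2), of k] by blast
  qed
qed

section \<open>Polynomial functions and genericity\<close>

definition monom_eval :: "('i \<Rightarrow> real) \<Rightarrow> ('i \<Rightarrow>\<^sub>0 nat) \<Rightarrow> real" where
  "monom_eval x m = (\<Prod>i\<in>Poly_Mapping.keys m. x i ^ Poly_Mapping.lookup m i)"

lemma monom_eval_superset:
  assumes "finite S" "Poly_Mapping.keys m \<subseteq> S"
  shows "monom_eval x m = (\<Prod>i\<in>S. x i ^ Poly_Mapping.lookup m i)"
  unfolding monom_eval_def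
  by (rule prod.mono_neutral_left) (use assms in \<open>auto simp: in_keys_iff\<close>)

lemma monom_eval_add: "monom_eval x (m + m') = monom_eval x m * monom_eval x m'"
proof -
  let ?S = "Poly_Mapping.keys m \<union> Poly_Mapping.keys m'"
  have "monom_eval x (m + m') = (\<Prod>i\<in>?S. x i ^ Poly_Mapping.lookup (m + m') i)"
    by (rule monom_eval_superset) (use keys_add[of m m'] in auto)
  then show ?thesis
    by (simp add: monom_eval_superset[of ?S] lookup_add power_add prod.distrib)
qed

lemma mpoly_eval_superset:
  assumes "finite S" "Poly_Mapping.keys q \<subseteq> S"
  shows "mpoly_eval x q = (\<Sum>m\<in>S. of_rat (Poly_Mapping.lookup q m) * monom_eval x m)"
  unfolding mpoly_eval_def monom_eval_def
  by (rule sum.mono_neutral_left) (use assms in \<open>auto simp: in_keys_iff\<close>)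

lemma mpoly_eval_add: "mpoly_eval x (p + q) = mpoly_eval x p + mpoly_eval x q"
proof -
  let ?S = "Poly_Mapping.keys p \<union> Poly_Mapping.keys q"
  have "mpoly_eval x (p + q) = (\<Sum>m\<in>?S. of_rat (Poly_Mapping.lookup (p + q) m) * monom_eval x m)"
    by (rule mpoly_eval_superset) (use keys_add[of p q] in auto)
  then show ?thesis
    by (simp add: mpoly_eval_superset[of ?S] lookup_add of_rat_add algebra_simps sum.distrib)
qed

lemma mpoly_eval_single: "mpoly_eval x (Poly_Mapping.single m c) = of_rat c * monom_eval x m"
  by (simp add: mpoly_eval_superset[of "{m}"])

text \<open>Polynomials are handled through the functions they define, so that determinants need
  only closure properties and no explicit polynomial. The coefficients are rational, as algebraic
  independence demands.\<close>

definition polyfun :: "'i set \<Rightarrow> (('i \<Rightarrow> real) \<Rightarrow> real) \<Rightarrow> bool" where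
  "polyfun J f \<longleftrightarrow> (\<exists>q. (\<forall>m\<in>Poly_Mapping.keys q. Poly_Mapping.keys m \<subseteq> J) \<and> (\<forall>x. mpoly_eval x q = f x))"

lemma polyfun_monom:
  assumes "Poly_Mapping.keys m \<subseteq> J"
  shows "polyfun J (\<lambda>x. of_rat c * monom_eval x m)"
  unfolding polyfun_def
  by (rule exI[of _ "Poly_Mapping.single m c"]) (use assms in \<open>simp add: mpoly_eval_single\<close>)

lemma polyfun_const: "polyfun J (\<lambda>_. of_rat c)"
  using polyfun_monom[of 0 J c] by (simp add: monom_eval_def)

lemma polyfun_0 [simp]: "polyfun J (\<lambda>_. 0)"
  and polyfun_1 [simp]: "polyfun J (\<lambda>_. 1)"
  and polyfun_of_int [simp]: "polyfun J (\<lambda>_. of_int k)"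
  using polyfun_const[of J 0] polyfun_const[of J 1] polyfun_const[of J "of_int k"] by simp_all

lemma polyfun_var:
  assumes "i \<in> J"
  shows "polyfun J (\<lambda>x. x i)"
  using polyfun_monom[of "Poly_Mapping.single i 1" J 1] assms by (simp add: monom_eval_def)

lemma polyfun_add:
  assumes "polyfun J f" "polyfun J g"
  shows "polyfun J (\<lambda>x. f x + g x)"
proof -
  obtain p q where p: "\<forall>m\<in>Poly_Mapping.keys p. Poly_Mapping.keys m \<subseteq> J" "\<forall>x. mpoly_eval x p = f x"
    and q: "\<forall>m\<in>Poly_Mapping.keys q. Poly_Mapping.keys m \<subseteq> J" "\<forall>x. mpoly_eval x q = g x"
    using assms unfolding polyfun_def by blast
  have "\<forall>m\<in>Poly_Mapping.keys (p + q). Poly_Mapping.keys m \<subseteq> J"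
    using p(1) q(1) keys_add[of p q] by (meson UnE subsetD)
  then show ?thesis unfolding polyfun_def
    by (intro exI[of _ "p + q"]) (use p q in \<open>simp add: mpoly_eval_add\<close>)
qed

lemma polyfun_sum:
  assumes "\<And>k. k \<in> K \<Longrightarrow> polyfun J (f k)"
  shows "polyfun J (\<lambda>x. \<Sum>k\<in>K. f k x)"
  using assms by (induction K rule: infinite_finite_induct) (auto intro: polyfun_add)

lemma polyfun_mult:
  assumes "polyfun J f" "polyfun J g"
  shows "polyfun J (\<lambda>x. f x * g x)"
proof -
  obtain p q where p: "\<forall>m\<in>Poly_Mapping.keys p. Poly_Mapping.keys m \<subseteq> J" "\<forall>x. mpoly_eval x p = f x"
    and q: "\<forall>m\<in>Poly_Mapping.keys q. Poly_Mapping.keys m \<subseteq> J" "\<forall>x. mpoly_eval x q = g x"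
    using assms unfolding polyfun_def by blast
  let ?t = "\<lambda>x m m'. of_rat (Poly_Mapping.lookup p m * Poly_Mapping.lookup q m') * monom_eval x (m + m')"
  have "f x * g x = (\<Sum>m\<in>Poly_Mapping.keys p. \<Sum>m'\<in>Poly_Mapping.keys q. ?t x m m')" for x
    unfolding p(2)[rule_format, symmetric] q(2)[rule_format, symmetric]
      mpoly_eval_superset[OF finite_keys subset_refl] sum_product
    by (simp add: monom_eval_add of_rat_mult mult_ac)
  moreover have "polyfun J (\<lambda>x. \<Sum>m\<in>Poly_Mapping.keys p. \<Sum>m'\<in>Poly_Mapping.keys q. ?t x m m')"
  proof (intro polyfun_sum polyfun_monom)
    show "Poly_Mapping.keys (m + m') \<subseteq> J"
      if "m \<in> Poly_Mapping.keys p" "m' \<in> Poly_Mapping.keys q" for m m'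
      using keys_add[of m m'] p(1) q(1) that by blast
  qed
  ultimately show ?thesis by simp
qed

lemma polyfun_prod:
  assumes "\<And>k. k \<in> K \<Longrightarrow> polyfun J (f k)"
  shows "polyfun J (\<lambda>x. \<Prod>k\<in>K. f k x)"
  using assms by (induction K rule: infinite_finite_induct) (auto intro: polyfun_mult)

lemma polyfun_diff:
  assumes "polyfun J f" "polyfun J g"
  shows "polyfun J (\<lambda>x. f x - g x)"
  using polyfun_add[OF assms(1) polyfun_mult[OF polyfun_of_int[of J "-1"] assms(2)]] by simp

text \<open>This is how genericity enters: a polynomial function that is nonzero at one special
  placement, rational or not, is nonzero at every generic one.\<close>

lemma polyfun_generic_zero:
  assumes "alg_independent J x" "polyfun J f" "f x = 0"
  shows "f y = 0"
proof -
  obtain q where q: "\<forall>m\<in>Poly_Mapping.keys q. Poly_Mapping.keys m \<subseteq> J" "\<And>x. mpoly_eval x q = f x"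
    using assms(2) unfolding polyfun_def by blast
  then have "q = 0" using assms(1,3) unfolding alg_independent_def by simp
  moreover have "f y = mpoly_eval y q" using q(2) by simp
  ultimately show ?thesis by (simp add: mpoly_eval_def)
qed

lemma alg_independent_subset:
  assumes "alg_independent J x" "J' \<subseteq> J"
  shows "alg_independent J' x"
  using assms unfolding alg_independent_def by blast

lemma polyfun_gdet:
  assumes "finite I" "\<And>x y. x \<in> I \<Longrightarrow> y \<in> I \<Longrightarrow> polyfun J (\<lambda>z. a z x y)"
  shows "polyfun J (\<lambda>z. gdet I (a z))"
proof -
  have mem: "enum_of I i \<in> I" if "i < card I" for i
    using enum_of[OF assms(1)] that by (auto simp: bij_betw_def)
  have "polyfun J (\<lambda>z. signof \<pi> * (\<Prod>i = 0..<card I. a z (enum_of I i) (enum_of I (\<pi> i))))"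
    if "\<pi> permutes {0..<card I}" for \<pi>
  proof (intro polyfun_mult polyfun_prod)
    show "polyfun J (\<lambda>z. real_of_int (sign \<pi>))" by simp
    show "polyfun J (\<lambda>z. a z (enum_of I i) (enum_of I (\<pi> i)))" if "i \<in> {0..<card I}" for i
      using that permutes_in_image[OF \<open>\<pi> permutes _\<close>, of i] by (intro assms(2) mem) auto
  qed
  then show ?thesis unfolding gdet_expand by (intro polyfun_sum) auto
qed

lemma polyfun_ip:
  assumes "\<And>i. i \<in> I \<Longrightarrow> polyfun J (\<lambda>z. f z i)" "\<And>i. i \<in> I \<Longrightarrow> polyfun J (\<lambda>z. g z i)"
  shows "polyfun J (\<lambda>z. ip I (f z) (g z))"
  unfolding ip_def using assms by (intro polyfun_sum polyfun_mult) auto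

lemma polyfun_gram:
  assumes "finite F" "\<And>e i. e \<in> F \<Longrightarrow> i \<in> I \<Longrightarrow> polyfun J (\<lambda>z. r z e i)"
  shows "polyfun J (\<lambda>z. gram I (r z) F)"
  unfolding gram_def using assms by (intro polyfun_gdet polyfun_ip) auto

text \<open>If \<open>R\<close> is the matrix with rows \<open>r z k\<close>, then
  \<open>M z\<close> is its square Gram matrix of columns, with the same kernel as \<open>R\<close>
  because \<open>w\<close> paired with \<open>M w\<close> is a sum of squares. Its determinant is a
  polynomial function, nonzero at \<open>z0\<close> and therefore at the generic
  \<open>y\<close>.\<close>

lemma trivial_kernel_generic:
  assumes "finite I" "finite K"
    and poly: "\<And>k i. k \<in> K \<Longrightarrow> i \<in> I \<Longrightarrow> polyfun J (\<lambda>z. r z k i)"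
    and gen: "alg_independent J y"
    and special: "\<And>u. (\<And>k. k \<in> K \<Longrightarrow> ip I (r z0 k) u = 0) \<Longrightarrow> \<forall>i\<in>I. u i = 0"
    and u: "\<And>k. k \<in> K \<Longrightarrow> ip I (r y k) u = 0"
  shows "\<forall>i\<in>I. u i = 0"
proof -
  define M where "M = (\<lambda>z i j. \<Sum>k\<in>K. r z k i * r z k j)"
  have M: "(\<Sum>j\<in>I. M z i j * w j) = (\<Sum>k\<in>K. r z k i * ip I (r z k) w)" for z i w
    unfolding M_def ip_def sum_distrib_right sum_distrib_left
    by (subst sum.swap) (simp add: mult.assoc)
  have "gdet I (M z0) \<noteq> 0"
  proof
    assume "gdet I (M z0) = 0"
    then obtain w where w: "\<exists>i\<in>I. w i \<noteq> 0" "\<forall>i\<in>I. (\<Sum>j\<in>I. M z0 i j * w j) = 0"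
      using gdet_eq_0_iff[OF assms(1)] by blast
    have "0 = (\<Sum>i\<in>I. w i * (\<Sum>j\<in>I. M z0 i j * w j))" using w(2) by simp
    also have "\<dots> = (\<Sum>k\<in>K. (ip I (r z0 k) w)\<^sup>2)"
      unfolding M power2_eq_square sum_distrib_left
      by (subst sum.swap) (simp add: ip_def sum_distrib_left sum_distrib_right mult_ac)
    finally have "\<forall>k\<in>K. ip I (r z0 k) w = 0"
      using assms(2) by (simp add: sum_nonneg_eq_0_iff)
    then show False using special w(1) by blast
  qed
  moreover have "polyfun J (\<lambda>z. gdet I (M z))"
    unfolding M_def using assms(1) poly by (intro polyfun_gdet polyfun_sum polyfun_mult) auto
  ultimately have "gdet I (M y) \<noteq> 0" using polyfun_generic_zero[OF gen] by blast
  moreover have "\<forall>i\<in>I. (\<Sum>j\<in>I. M y i j * u j) = 0" unfolding M using u by simp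
  ultimately show ?thesis using gdet_eq_0_iff[OF assms(1)] by blast
qed

section \<open>From infinitesimal to continuous rigidity\<close>

lemma continuous_on_gdet:
  assumes "finite I" "\<And>x y. x \<in> I \<Longrightarrow> y \<in> I \<Longrightarrow> continuous_on S (\<lambda>t. a t x y)"
  shows "continuous_on S (\<lambda>t. gdet I (a t))"
proof -
  have mem: "enum_of I i \<in> I" if "i < card I" for i
    using enum_of[OF assms(1)] that by (auto simp: bij_betw_def)
  have "continuous_on S (\<lambda>t. signof \<pi> * (\<Prod>i = 0..<card I. a t (enum_of I i) (enum_of I (\<pi> i))))"
    if "\<pi> permutes {0..<card I}" for \<pi>
  proof (intro continuous_on_mult continuous_on_prod continuous_on_const)
    show "continuous_on S (\<lambda>t. a t (enum_of I i) (enum_of I (\<pi> i)))" if "i \<in> {0..<card I}" for i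
      using that permutes_in_image[OF \<open>\<pi> permutes _\<close>, of i] by (intro assms(2) mem) auto
  qed
  then show ?thesis unfolding gdet_expand by (intro continuous_on_sum) auto
qed

lemma continuous_on_gram:
  assumes "finite F" "\<And>e i. e \<in> F \<Longrightarrow> i \<in> I \<Longrightarrow> continuous_on S (\<lambda>t. r t e i)"
  shows "continuous_on S (\<lambda>t. gram I (r t) F)"
  unfolding gram_def ip_def using assms
  by (intro continuous_on_gdet continuous_on_sum continuous_on_mult) auto

text \<open>A row of the rigidity matrix. The infinitesimal motions of a framework are the vectors
  orthogonal to the rows of its edges.\<close>

definition edge_row :: "('a \<times> nat \<Rightarrow> real) \<Rightarrow> 'a \<times> 'a \<Rightarrow> 'a \<times> nat \<Rightarrow> real" where
  "edge_row y e x = (of_bool (fst x = fst e) - of_bool (fst x = snd e)) * (y (fst e, snd x) - y (snd e, snd x))"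

definition sqd :: "nat \<Rightarrow> ('a \<times> nat \<Rightarrow> real) \<Rightarrow> 'a \<Rightarrow> 'a \<Rightarrow> real" where
  "sqd d y v w = (\<Sum>i<d. (y (v, i) - y (w, i))\<^sup>2)"

lemma ip_edge_row:
  assumes "finite V" "v \<in> V" "w \<in> V"
  shows "ip (V \<times> {..<d}) (edge_row y (v, w)) u = (\<Sum>i<d. (y (v, i) - y (w, i)) * (u (v, i) - u (w, i)))"
proof -
  have *: "(\<Sum>x\<in>V. (of_bool (x = v) - of_bool (x = w)) * g x) = g v - g w" for g :: "'a \<Rightarrow> real"
    using assms by (simp add: left_diff_distrib sum_subtractf of_bool_def if_distrib[of "\<lambda>t. t * _"] cong: if_cong)
  have "ip (V \<times> {..<d}) (edge_row y (v, w)) u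
      = (\<Sum>i<d. \<Sum>x\<in>V. (of_bool (x = v) - of_bool (x = w)) * ((y (v, i) - y (w, i)) * u (x, i)))"
    unfolding ip_def edge_row_def by (subst sum.swap) (simp add: sum.cartesian_product' mult.assoc)
  then show ?thesis unfolding * by (simp add: right_diff_distrib)
qed

text \<open>Polarization turns the product of two difference vectors into squared distances, and the
  first factor depends only on which endpoints coincide. Hence Gram determinants of edge rows are
  invariant under congruence.\<close>

lemma ip_edge_rows:
  assumes "finite V"
  shows "ip (V \<times> {..<d}) (edge_row y (v, w)) (edge_row y (v', w')) =
    (\<Sum>x\<in>V. (of_bool (x = v) - of_bool (x = w)) * (of_bool (x = v') - of_bool (x = w'))) *
    ((sqd d y v w' + sqd d y w v' - sqd d y v v' - sqd d y w w') / 2)"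
proof -
  have "(\<Sum>i<d. (y (v, i) - y (w, i)) * (y (v', i) - y (w', i)))
      = (\<Sum>i<d. ((y (v, i) - y (w', i))\<^sup>2 + (y (w, i) - y (v', i))\<^sup>2 - (y (v, i) - y (v', i))\<^sup>2
          - (y (w, i) - y (w', i))\<^sup>2) / 2)"
    by (rule sum.cong) (auto simp: power2_eq_square algebra_simps)
  also have "\<dots> = (sqd d y v w' + sqd d y w v' - sqd d y v v' - sqd d y w w') / 2"
    by (simp add: sqd_def sum.distrib sum_subtractf flip: sum_divide_distrib)
  finally have *: "(\<Sum>i<d. (y (v, i) - y (w, i)) * (y (v', i) - y (w', i)))
      = (sqd d y v w' + sqd d y w v' - sqd d y v v' - sqd d y w w') / 2" .
  show ?thesis unfolding *[symmetric] sum_product ip_def edge_row_def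
    by (simp add: sum.cartesian_product' mult_ac)
qed

lemma gram_edge_row_congruent:
  assumes "finite V" "F \<subseteq> V \<times> V" "\<And>v w. v \<in> V \<Longrightarrow> w \<in> V \<Longrightarrow> sqd d y v w = sqd d z v w"
  shows "gram (V \<times> {..<d}) (edge_row y) F = gram (V \<times> {..<d}) (edge_row z) F"
  unfolding gram_def
proof (rule gdet_cong)
  show "finite F" using assms(1,2) finite_subset by blast
  show "ip (V \<times> {..<d}) (edge_row y e) (edge_row y f) = ip (V \<times> {..<d}) (edge_row z e) (edge_row z f)"
    if "e \<in> F" "f \<in> F" for e f
  proof -
    obtain v w v' w' where "e = (v, w)" "f = (v', w')" by (metis surj_pair)
    moreover then have "v \<in> V" "w \<in> V" "v' \<in> V" "w' \<in> V" using that assms(2) by auto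
    ultimately show ?thesis by (simp add: ip_edge_rows[OF assms(1)] assms(3))
  qed
qed

text \<open>A difference of squares factors into sum and difference. When both placements give
  \<open>v w\<close> the same length, their difference is therefore orthogonal to the row of
  \<open>v w\<close> at the midpoint.\<close>

lemma midpoint_motion:
  assumes "finite V" "v \<in> V" "w \<in> V"
  shows "ip (V \<times> {..<d}) (edge_row (\<lambda>x. (y x + z x) / 2) (v, w)) (\<lambda>x. y x - z x) = (sqd d y v w - sqd d z v w) / 2"
  unfolding ip_edge_row[OF assms] sqd_def sum_subtractf[symmetric] sum_divide_distrib
  by (rule sum.cong) (auto simp: power2_eq_square field_simps)

lemma polyfun_edge_row:
  assumes "v \<in> V" "w \<in> V" "x \<in> U \<times> {..<d}"
  shows "polyfun (V \<times> {..<d}) (\<lambda>y. edge_row y (v, w) x)"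
proof -
  have "polyfun (V \<times> {..<d}) (\<lambda>y. of_int (of_bool (fst x = v) - of_bool (fst x = w)) * (y (v, snd x) - y (w, snd x)))"
    using assms by (intro polyfun_mult polyfun_diff polyfun_var polyfun_of_int) auto
  then show ?thesis by (simp add: edge_row_def)
qed

text \<open>The times at which all distances have their initial values form a nonempty clopen subset
  of \<open>{0..1}\<close>. For openness, a row basis \<open>F\<close> at \<open>y\<close> stays
  independent at midpoints near a congruent placement, while every further pair row depends on
  \<open>F\<close> at every placement.\<close>

lemma generic_infinitesimally_rigid_imp_rigid:
  fixes \<gamma> :: "real \<Rightarrow> 'a \<times> nat \<Rightarrow> real"
  assumes V: "finite V" and E: "E \<subseteq> V \<times> V"
    and gen: "alg_independent (V \<times> {..<d}) y"
    and inf: "\<And>u e. (\<And>e. e \<in> E \<Longrightarrow> ip (V \<times> {..<d}) (edge_row y e) u = 0) \<Longrightarrow> e \<in> V \<times> V \<Longrightarrow>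
                ip (V \<times> {..<d}) (edge_row y e) u = 0"
    and cont: "\<And>x. x \<in> V \<times> {..<d} \<Longrightarrow> continuous_on {0..1} (\<lambda>t. \<gamma> t x)"
    and init: "\<And>x. x \<in> V \<times> {..<d} \<Longrightarrow> \<gamma> 0 x = y x"
    and edges: "\<And>t v w. t \<in> {0..1} \<Longrightarrow> (v, w) \<in> E \<Longrightarrow> sqd d (\<gamma> t) v w = sqd d y v w"
    and t: "t \<in> {0..1}" and vw: "v \<in> V" "w \<in> V"
  shows "sqd d (\<gamma> t) v w = sqd d y v w"
proof -
  let ?I = "V \<times> {..<d}"
  have I: "finite ?I" using V by simp
  have finE: "finite E" using V E finite_subset by blast
  obtain F where F: "F \<subseteq> E" "gram ?I (edge_row y) F \<noteq> 0"
    "\<And>e. e \<in> E \<Longrightarrow> e \<notin> F \<Longrightarrow> gram ?I (edge_row y) (insert e F) = 0"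
    using gram_basis[OF I finE, of "edge_row y"] by metis
  have finF: "finite F" using F(1) finE finite_subset by blast
  have FV: "F \<subseteq> V \<times> V" using F(1) E by (rule subset_trans)
  have dep: "gram ?I (edge_row z) (insert e F) = 0" if e: "e \<in> V \<times> V" "e \<notin> F" for z e
  proof -
    have "gram ?I (edge_row y) (insert e F) = 0"
    proof (rule ccontr)
      assume nz: "gram ?I (edge_row y) (insert e F) \<noteq> 0"
      \<comment> \<open>If row \<open>e\<close> were independent of \<open>F\<close>, some
        \<open>u\<close> would be orthogonal to all of \<open>F\<close> but not to \<open>e\<close>.
        Since \<open>F\<close> spans the rows of \<open>E\<close>, this \<open>u\<close> would be an
        infinitesimal motion contradicting \<open>inf\<close>.\<close>
      obtain c where c: "\<forall>f\<in>insert e F. ip ?I (edge_row y f) (\<lambda>x. \<Sum>f\<in>insert e F. c f * edge_row y f x)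
          = (if f = e then 1 else 0)"
        using gram_solve[OF _ nz, of "\<lambda>f. if f = e then 1 else 0"] finF by auto
      define u where "u = (\<lambda>x. \<Sum>f\<in>insert e F. c f * edge_row y f x)"
      have uF: "ip ?I (edge_row y f) u = 0" if "f \<in> F" for f
        using c that e(2) unfolding u_def by auto
      have uE: "ip ?I (edge_row y g) u = 0" if "g \<in> E" for g
      proof (cases "g \<in> F")
        case False
        show ?thesis by (rule gram_insert_dependent[OF I finF F(2) F(3)[OF that False] uF])
      qed (rule uF)
      have "ip ?I (edge_row y e) u = 0" using inf[OF uE e(1)] .
      then show False using c unfolding u_def by simp
    qed
    moreover have "polyfun ?I (\<lambda>z. gram ?I (edge_row z) (insert e F))"
      using finF FV e(1) by (intro polyfun_gram) (auto intro!: polyfun_edge_row)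
    ultimately show ?thesis using polyfun_generic_zero[OF gen, of "\<lambda>z. gram ?I (edge_row z) (insert e F)" z] by simp
  qed
  \<comment> \<open>Collecting all conditions into one sum of absolute values makes \<open>S\<close>
    the zero set of a single continuous function, hence closed.\<close>
  define S where "S = {t \<in> {0..1}. (\<Sum>(v, w)\<in>V \<times> V. \<bar>sqd d (\<gamma> t) v w - sqd d y v w\<bar>) = 0}"
  have S: "t \<in> S \<longleftrightarrow> t \<in> {0..1} \<and> (\<forall>v\<in>V. \<forall>w\<in>V. sqd d (\<gamma> t) v w = sqd d y v w)" for t
    unfolding S_def using V by (subst mem_Collect_eq, subst sum_nonneg_eq_0_iff) auto
  have "continuous_on {0..1} (\<lambda>t. \<Sum>(v, w)\<in>V \<times> V. \<bar>sqd d (\<gamma> t) v w - sqd d y v w\<bar>)"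
    unfolding sqd_def case_prod_unfold by (intro continuous_intros cont) auto
  then have closed: "closedin (top_of_set {0..1}) S"
    unfolding S_def by (rule continuous_closedin_preimage_constant)
  have "openin (top_of_set {0..1}) S"
  proof (subst openin_subopen, intro ballI)
    fix s assume s: "s \<in> S"
    then have s01: "s \<in> {0..1}" using S by blast
    \<comment> \<open>The midpoint placement. At \<open>t = s\<close> it equals
      \<open>\<gamma> s\<close>, which is congruent to \<open>y\<close>, so its Gram determinant on
      \<open>F\<close> is nonzero there and, by continuity, nearby.\<close>
    define m where "m = (\<lambda>t x. (\<gamma> t x + \<gamma> s x) / 2)"
    define T where "T = {0..1} \<inter> (\<lambda>t. gram ?I (edge_row (m t)) F) -` (- {0})"
    have "continuous_on {0..1} (\<lambda>t. gram ?I (edge_row (m t)) F)"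
      unfolding edge_row_def m_def using finF FV
      by (intro continuous_on_gram continuous_intros cont) auto
    then have "openin (top_of_set {0..1}) T"
      unfolding T_def by (rule continuous_openin_preimage_gen) (rule open_Compl, simp)
    moreover have "s \<in> T"
    proof -
      have "m s = \<gamma> s" unfolding m_def by auto
      then have "gram ?I (edge_row (m s)) F = gram ?I (edge_row y) F"
        using s S gram_edge_row_congruent[OF V FV, of d "\<gamma> s" y] by simp
      then show ?thesis unfolding T_def using F(2) s01 by simp
    qed
    moreover have "T \<subseteq> S"
    proof
      fix t assume "t \<in> T"
      then have t01: "t \<in> {0..1}" and nz: "gram ?I (edge_row (m t)) F \<noteq> 0" unfolding T_def by auto
      define u where "u = (\<lambda>x. \<gamma> t x - \<gamma> s x)"
      have mu: "ip ?I (edge_row (m t) (v, w)) u = (sqd d (\<gamma> t) v w - sqd d (\<gamma> s) v w) / 2"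
        if "v \<in> V" "w \<in> V" for v w
        unfolding m_def u_def by (rule midpoint_motion[OF V that])
      have uF: "ip ?I (edge_row (m t) f) u = 0" if "f \<in> F" for f
      proof -
        obtain v w where f: "f = (v, w)" by fastforce
        then have "(v, w) \<in> E" "v \<in> V" "w \<in> V" using that F(1) FV by auto
        then show ?thesis using mu[of v w] edges[OF t01, of v w] edges[OF s01, of v w] f by simp
      qed
      have "sqd d (\<gamma> t) v w = sqd d y v w" if "v \<in> V" "w \<in> V" for v w
      proof -
        have "ip ?I (edge_row (m t) (v, w)) u = 0"
        proof (cases "(v, w) \<in> F")
          case False
          show ?thesis
            by (rule gram_insert_dependent[OF I finF nz dep[OF _ False] uF]) (use that in simp)
        qed (rule uF)
        then show ?thesis using mu[OF that] s S that by simp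
      qed
      then show "t \<in> S" using S t01 by blast
    qed
    ultimately show "\<exists>T. openin (top_of_set {0..1}) T \<and> s \<in> T \<and> T \<subseteq> S" by blast
  qed
  moreover have "0 \<in> S" using init by (auto simp: S sqd_def)
  moreover have "connected {0..1::real}" by simp
  ultimately have "S = {0..1}" using closed unfolding connected_clopen by blast
  then show ?thesis using S t vw by blast
qed

section \<open>Clustered placements on the moment curve\<close>

text \<open>With \<open>A\<close> skew-symmetric these are the velocity fields of rigid motions of
  Euclidean space: an infinitesimal rotation plus a translation.\<close>

definition affine_skew :: "nat \<Rightarrow> (nat \<Rightarrow> nat \<Rightarrow> real) \<Rightarrow> (nat \<Rightarrow> real) \<Rightarrow> (nat \<Rightarrow> real) \<Rightarrow> nat \<Rightarrow> real" where
  "affine_skew d A b x i = (\<Sum>k<d. A i k * x k) + b i"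

definition skew :: "nat \<Rightarrow> (nat \<Rightarrow> nat \<Rightarrow> real) \<Rightarrow> bool" where
  "skew d A \<longleftrightarrow> (\<forall>i<d. \<forall>k<d. A i k = - A k i)"

lemma skew_form_zero:
  assumes "skew d A"
  shows "(\<Sum>i<d. x i * (\<Sum>k<d. A i k * x k)) = 0"
proof -
  let ?s = "\<Sum>i<d. \<Sum>k<d. x i * (A i k * x k)"
  have "?s = (\<Sum>k<d. \<Sum>i<d. x i * (A i k * x k))" by (rule sum.swap)
  also have "\<dots> = (\<Sum>k<d. \<Sum>i<d. - (x k * (A k i * x i)))"
    using assms unfolding skew_def by (intro sum.cong refl) (metis lessThan_iff mult.commute mult.left_commute mult_minus_left)
  also have "\<dots> = - ?s" by (simp add: sum_negf)
  finally show ?thesis by (simp add: sum_distrib_left)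
qed

lemma affine_skew_diff:
  "affine_skew d A b x i - affine_skew d A b x' i = (\<Sum>k<d. A i k * (x k - x' k))"
  by (simp add: affine_skew_def right_diff_distrib sum_subtractf)

lemma affine_skew_edge:
  assumes "skew d A"
  shows "(\<Sum>i<d. (x i - x' i) * (affine_skew d A b x i - affine_skew d A b x' i)) = 0"
  unfolding affine_skew_diff by (rule skew_form_zero[OF assms])

definition trivial_motion :: "nat \<Rightarrow> 'a set \<Rightarrow> ('a \<times> nat \<Rightarrow> real) \<Rightarrow> ('a \<times> nat \<Rightarrow> real) \<Rightarrow> bool" where
  "trivial_motion d V y u \<longleftrightarrow>
     (\<exists>A b. skew d A \<and> (\<forall>v\<in>V. \<forall>i<d. u (v, i) = affine_skew d A b (\<lambda>k. y (v, k)) i))"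

section \<open>General position on the moment curve, and its complete frameworks\<close>

lemma vandermonde_kernel:
  fixes x :: "nat \<Rightarrow> real" and S :: "nat set"
  assumes "d < card S" "\<And>j. j \<in> S \<Longrightarrow> (\<Sum>k\<le>d. real j ^ k * x k) = 0" "k \<le> d"
  shows "x k = 0"
proof -
  define f where "f = (\<Sum>k\<le>d. monom (x k) k)"
  have deg: "degree f \<le> d"
    unfolding f_def by (rule degree_sum_le) (auto intro: order_trans[OF degree_monom_le])
  have "f = 0"
  proof (rule poly_eqI_degree[of "real ` S"])
    show "poly f z = poly 0 z" if "z \<in> real ` S" for z
      using that assms(2) by (auto simp: f_def poly_sum poly_monom mult.commute)
  qed (use deg assms(1) in \<open>simp_all add: card_image\<close>)
  moreover have "coeff f k = x k"
    using assms(3) by (simp add: f_def coeff_sum)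
  ultimately show ?thesis by simp
qed

text \<open>The exponents start at 1, so that a constant coordinate put in front completes a
  Vandermonde row.\<close>

definition moment_pt :: "nat \<Rightarrow> nat \<Rightarrow> real" where
  "moment_pt i k = real i ^ Suc k"

text \<open>The hypotheses say that the linear functional \<open>x\<close> takes one common value at
  \<open>i\<close> and at all of \<open>S\<close>. Subtracting this value yields a polynomial of
  degree at most \<open>d\<close> with at least \<open>d + 1\<close> roots.\<close>

lemma moment_general_position:
  assumes "finite S" "d \<le> card S" "i \<notin> S" "\<And>j. j \<in> S \<Longrightarrow> (\<Sum>k<d. (moment_pt i k - moment_pt j k) * x k) = 0" "k < d"
  shows "x k = 0"
proof -
  let ?c = "\<Sum>k<d. moment_pt i k * x k"
  let ?z = "\<lambda>k. case k of 0 \<Rightarrow> - ?c | Suc k \<Rightarrow> x k"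
  have "?z (Suc k) = 0"
  proof (rule vandermonde_kernel[of d "insert i S"])
    show "(\<Sum>k\<le>d. real j ^ k * ?z k) = 0" if "j \<in> insert i S" for j
    proof -
      have "(\<Sum>k<d. moment_pt j k * x k) = ?c"
        using that assms(4)[of j] by (auto simp: left_diff_distrib sum_subtractf)
      then show ?thesis by (simp add: sum.atMost_shift moment_pt_def)
    qed
  qed (use assms in auto)
  then show ?thesis by simp
qed

lemma moment_interpolation:
  "\<exists>a \<beta>. \<forall>i\<le>d. (\<Sum>k<d. a k * moment_pt i k) + \<beta> = g i"
proof -
  have "gdet {..d} (\<lambda>i k. real i ^ k) \<noteq> 0"
  proof
    assume "gdet {..d} (\<lambda>i k. real i ^ k) = 0"
    then obtain x where "\<exists>i\<in>{..d}. x i \<noteq> 0" "\<forall>i\<in>{..d}. (\<Sum>j\<in>{..d}. real i ^ j * x j) = 0"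
      using gdet_eq_0_iff[of "{..d}"] by auto
    then show False using vandermonde_kernel[of d "{..d}" x] by auto
  qed
  then obtain x where "\<forall>i\<in>{..d}. (\<Sum>j\<in>{..d}. real i ^ j * x j) = g i"
    using gdet_solve[of "{..d}" "\<lambda>i k. real i ^ k" g] by auto
  then show ?thesis
    by (intro exI[of _ "\<lambda>k. x (Suc k)"] exI[of _ "x 0"])
       (auto simp: sum.atMost_shift moment_pt_def ac_simps)
qed

text \<open>An affine map is fitted to the velocities of the first \<open>d + 1\<close> points. The
  edges among these force its linear part to be skew, and any other point is tied to enough of them
  to follow the same map.\<close>

lemma complete_moment_framework:
  assumes "d < M"
    and edge: "\<And>i j. i < M \<Longrightarrow> j < M \<Longrightarrow> (\<Sum>k<d. (moment_pt i k - moment_pt j k) * (X i k - X j k)) = 0"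
  shows "\<exists>A b. skew d A \<and> (\<forall>i<M. \<forall>l<d. X i l = affine_skew d A b (moment_pt i) l)"
proof -
  have "\<exists>a \<beta>. \<forall>i\<le>d. (\<Sum>k<d. a k * moment_pt i k) + \<beta> = X i l" for l
    by (rule moment_interpolation)
  then obtain A b where Ab: "\<And>l i. i \<le> d \<Longrightarrow> (\<Sum>k<d. A l k * moment_pt i k) + b l = X i l" by metis
  have X: "X i l = affine_skew d A b (moment_pt i) l" if "i \<le> d" for i l
    using Ab[OF that, of l] by (simp add: affine_skew_def)
  \<comment> \<open>The vectors \<open>e i\<close> for \<open>i\<close> in \<open>{1..d}\<close>
    span the space, and \<open>Q\<close> is the bilinear form of \<open>A\<close>. The edge
    equations make \<open>Q\<close> vanish on the diagonal at every difference of the points, and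
    polarization gives \<open>Qe\<close>.\<close>
  define e where "e = (\<lambda>i k. moment_pt 0 k - moment_pt i k)"
  define Q where "Q = (\<lambda>x z :: nat \<Rightarrow> real. \<Sum>l<d. \<Sum>k<d. x l * (A l k * z k))"
  have Q0: "Q (\<lambda>k. moment_pt i k - moment_pt j k) (\<lambda>k. moment_pt i k - moment_pt j k) = 0"
    if "i \<le> d" "j \<le> d" for i j
    using edge[of i j] that assms(1) by (simp add: X affine_skew_diff Q_def sum_distrib_left)
  have Qe: "Q (e i) (e j) + Q (e j) (e i) = 0" if "i \<le> d" "j \<le> d" for i j
  proof -
    have "Q (\<lambda>k. e i k - e j k) (\<lambda>k. e i k - e j k) = Q (e i) (e i) + Q (e j) (e j) - (Q (e i) (e j) + Q (e j) (e i))"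
      unfolding Q_def by (simp add: sum.distrib sum_subtractf algebra_simps)
    moreover have "(\<lambda>k. e i k - e j k) = (\<lambda>k. moment_pt j k - moment_pt i k)" by (auto simp: e_def)
    moreover have "Q (e i) (e i) = 0" "Q (e j) (e j) = 0" using Q0[of 0 i] Q0[of 0 j] that by (auto simp: e_def)
    ultimately show ?thesis using Q0[of j i] that by simp
  qed
  have e0: "\<forall>l<d. z l = 0" if "\<And>i. i \<in> {1..d} \<Longrightarrow> (\<Sum>l<d. e i l * z l) = 0" for z
    using moment_general_position[of "{1..d}" d 0 z] that by (auto simp: e_def)
  \<comment> \<open>Twice the symmetric part of \<open>A\<close>. It is killed by pairing each of
    its two arguments with the spanning vectors \<open>e i\<close> in turn.\<close>
  define B where "B = (\<lambda>l k. A l k + A k l)"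
  have Be: "(\<Sum>k<d. e j k * B l k) = 0" if "j \<in> {1..d}" "l < d" for j l
  proof -
    have "(\<Sum>l<d. e i l * (\<Sum>k<d. e j k * B l k)) = 0" if "i \<in> {1..d}" for i
    proof -
      have "(\<Sum>l<d. e i l * (\<Sum>k<d. e j k * B l k)) = Q (e i) (e j) + (\<Sum>l<d. \<Sum>k<d. e j k * (A k l * e i l))"
        unfolding B_def Q_def by (simp add: sum_distrib_left sum.distrib algebra_simps)
      also have "(\<Sum>l<d. \<Sum>k<d. e j k * (A k l * e i l)) = Q (e j) (e i)" unfolding Q_def by (rule sum.swap)
      finally show ?thesis using Qe[of i j] that \<open>j \<in> {1..d}\<close> by simp
    qed
    then show ?thesis using e0[of "\<lambda>l. \<Sum>k<d. e j k * B l k"] that(2) by simp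
  qed
  have "B l k = 0" if "l < d" "k < d" for l k
    using e0[of "B l"] Be[OF _ that(1)] that(2) by simp
  then have sk: "skew d A" unfolding skew_def B_def by (simp add: eq_neg_iff_add_eq_0)
  have "X j l = affine_skew d A b (moment_pt j) l" if j: "j < M" and l: "l < d" for j l
  proof -
    let ?Y = "\<lambda>j. affine_skew d A b (moment_pt j)"
    \<comment> \<open>Removing \<open>j\<close> from the \<open>d + 1\<close> reference points, if
      it is one of them, still leaves the \<open>d\<close> directions required.\<close>
    have "X j l - ?Y j l = 0"
    proof (rule moment_general_position[of "{..d} - {j}" d j])
      show "d \<le> card ({..d} - {j})" by (cases "j \<le> d") (auto simp: card_Diff_singleton_if)
      show "(\<Sum>k<d. (moment_pt j k - moment_pt i k) * (X j k - ?Y j k)) = 0" if "i \<in> {..d} - {j}" for i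
      proof -
        have "i \<le> d" "i < M" using that assms(1) by auto
        have "(\<Sum>k<d. (moment_pt j k - moment_pt i k) * (X j k - ?Y j k))
          = (\<Sum>k<d. (moment_pt j k - moment_pt i k) * (X j k - X i k))
            - (\<Sum>k<d. (moment_pt j k - moment_pt i k) * (?Y j k - ?Y i k))"
          by (simp add: X[OF \<open>i \<le> d\<close>] flip: sum_subtractf) (simp add: algebra_simps)
        then show ?thesis using edge[OF j \<open>i < M\<close>] affine_skew_edge[OF sk] by simp
      qed
    qed (use l in auto)
    then show ?thesis by simp
  qed
  then show ?thesis using sk by blast
qed

section \<open>Frameworks whose colour classes are collapsed to points\<close>

definition clustered :: "('a \<Rightarrow> nat) \<Rightarrow> 'a \<times> nat \<Rightarrow> real" where
  "clustered c x = moment_pt (c (fst x)) (snd x)"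

text \<open>Connectedness makes the component of \<open>u\<close> along the difference of the points
  \<open>i\<close> and \<open>j\<close> a constant \<open>a i j\<close> on each pair
  \<open>T i j\<close>, \<open>T j i\<close>. Vertices missing few colours determine one velocity
  \<open>X i\<close> per colour, these velocities solve the complete framework, and every other
  vertex follows by \<open>d\<close> directions.\<close>

lemma clustered_framework_motions_trivial:
  fixes c :: "'a \<Rightarrow> nat"
  assumes "0 < d" "finite W" and c: "\<And>v. v \<in> W \<Longrightarrow> c v < 2 * d"
    and T: "\<And>i j. i < 2 * d \<Longrightarrow> j < 2 * d \<Longrightarrow> i \<noteq> j \<Longrightarrow> T i j \<subseteq> {v \<in> W. c v = i}"
    and conn: "\<And>i j (\<phi> :: 'a \<Rightarrow> real). i < 2 * d \<Longrightarrow> j < 2 * d \<Longrightarrow> i \<noteq> j \<Longrightarrow>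
       (\<And>v w. v \<in> T i j \<Longrightarrow> w \<in> T j i \<Longrightarrow> (v, w) \<in> E \<Longrightarrow> \<phi> v = \<phi> w) \<Longrightarrow> \<exists>a. \<forall>v\<in>T i j \<union> T j i. \<phi> v = a"
    and many: "\<And>v. v \<in> W \<Longrightarrow> d \<le> card {j. j < 2 * d \<and> j \<noteq> c v \<and> v \<in> T (c v) j}"
    and excellent: "\<And>i j. i < 2 * d \<Longrightarrow> j < 2 * d \<Longrightarrow> i \<noteq> j \<Longrightarrow>
       \<exists>v\<in>T i j. 2 * card {j. j < 2 * d \<and> j \<noteq> i \<and> v \<notin> T i j} < d"
    and motion: "\<And>v w. v \<in> W \<Longrightarrow> w \<in> W \<Longrightarrow> (v, w) \<in> E \<Longrightarrow>
       ip (W \<times> {..<d}) (edge_row (clustered c) (v, w)) u = 0"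
  shows "trivial_motion d W (clustered c) u"
proof -
  let ?dir = "\<lambda>i j v. \<Sum>k<d. (moment_pt i k - moment_pt j k) * u (v, k)"
  let ?exc = "\<lambda>i v. 2 * card {j. j < 2 * d \<and> j \<noteq> i \<and> v \<notin> T i j} < d"
  have "\<exists>a. \<forall>v\<in>T i j \<union> T j i. ?dir i j v = a" if ij: "i < 2 * d" "j < 2 * d" "i \<noteq> j" for i j
  proof (rule conn[OF ij])
    fix v w assume vw: "v \<in> T i j" "w \<in> T j i" "(v, w) \<in> E"
    then have "v \<in> W" "c v = i" "w \<in> W" "c w = j" using T[of i j] T[of j i] ij by auto
    then have "?dir i j v - ?dir i j w = 0"
      using motion[of v w] vw(3) ip_edge_row[OF assms(2), of v w d "clustered c" u]
      by (simp add: clustered_def right_diff_distrib flip: sum_subtractf)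
    then show "?dir i j v = ?dir i j w" by simp
  qed
  then obtain a where a: "\<And>i j v. i < 2 * d \<Longrightarrow> j < 2 * d \<Longrightarrow> i \<noteq> j \<Longrightarrow> v \<in> T i j \<union> T j i \<Longrightarrow> ?dir i j v = a i j"
    by metis
  have agree: "u (v, k) = u (w, k)"
    if i: "i < 2 * d" and v: "v \<in> W" "c v = i" "?exc i v" and w: "w \<in> W" "c w = i" "?exc i w" and k: "k < d"
    for i v w k
  proof -
    let ?N = "{..<2 * d} - {i}"
    let ?bv = "{j. j < 2 * d \<and> j \<noteq> i \<and> v \<notin> T i j}" and ?bw = "{j. j < 2 * d \<and> j \<noteq> i \<and> w \<notin> T i j}"
    let ?S = "?N - (?bv \<union> ?bw)"
    have "card (?bv \<union> ?bw) \<le> card ?bv + card ?bw" by (rule card_Un_le)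
    moreover have "card ?N - card (?bv \<union> ?bw) \<le> card ?S" by (rule diff_card_le_card_Diff) simp
    moreover have "card ?N = 2 * d - 1" using i by simp
    \<comment> \<open>Each vertex misses fewer than \<open>d / 2\<close> colours, so together they
      miss at most \<open>d - 1\<close>, and at least \<open>(2 * d - 1) - (d - 1) = d\<close>
      remain.\<close>
    ultimately have card: "d \<le> card ?S" using v(3) w(3) by linarith
    have "u (v, k) - u (w, k) = 0"
    proof (rule moment_general_position[of ?S d i "\<lambda>k. u (v, k) - u (w, k)"])
      show "(\<Sum>k<d. (moment_pt i k - moment_pt j k) * (u (v, k) - u (w, k))) = 0" if "j \<in> ?S" for j
        using that a[of i j v] a[of i j w] i by (auto simp: right_diff_distrib sum_subtractf)
    qed (use card k in auto)
    then show ?thesis by simp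
  qed
  have "\<exists>v. v \<in> W \<and> c v = i \<and> ?exc i v" if i: "i < 2 * d" for i
  proof -
    obtain j where j: "j < 2 * d" "i \<noteq> j"
      by (rule that[of "if i = 0 then 1 else 0"]) (use assms(1) in auto)
    obtain v where "v \<in> T i j" "?exc i v" using excellent[OF i j] by auto
    then show ?thesis using T[OF i j] by auto
  qed
  then have "\<forall>i. \<exists>v. i < 2 * d \<longrightarrow> v \<in> W \<and> c v = i \<and> ?exc i v" by simp
  then obtain r where r': "\<forall>i. i < 2 * d \<longrightarrow> r i \<in> W \<and> c (r i) = i \<and> ?exc i (r i)"
    using choice[of "\<lambda>i v. i < 2 * d \<longrightarrow> v \<in> W \<and> c v = i \<and> ?exc i v"] by auto
  have r: "r i \<in> W" "c (r i) = i" "?exc i (r i)" if "i < 2 * d" for i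
    using r' that by simp_all
  define X where "X = (\<lambda>i k. u (r i, k))"
  \<comment> \<open>Both \<open>T i j\<close> and \<open>T j i\<close> contain a vertex moving like
    the representative of its colour, so \<open>a i j\<close> can be read off at either end.
    Equating the two readings gives the edge equation between the points \<open>i\<close> and
    \<open>j\<close>.\<close>
  have aX: "a i j = (\<Sum>k<d. (moment_pt i k - moment_pt j k) * X i k)" 
    "a i j = (\<Sum>k<d. (moment_pt i k - moment_pt j k) * X j k)"
    if ij: "i < 2 * d" "j < 2 * d" "i \<noteq> j" for i j
  proof -
    obtain v where v: "v \<in> T i j" "?exc i v" using excellent[OF ij] by auto
    then have "v \<in> W" "c v = i" using T[OF ij] by auto
    then have "u (v, k) = X i k" if "k < d" for k
      unfolding X_def by (rule agree[OF ij(1) _ _ v(2) r[OF ij(1)] that])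
    then show "a i j = (\<Sum>k<d. (moment_pt i k - moment_pt j k) * X i k)"
      using a[OF ij, of v] v(1) by simp
    obtain w where w: "w \<in> T j i" "?exc j w" using excellent[of j i] ij by auto
    then have "w \<in> W" "c w = j" using T[of j i] ij by auto
    then have "u (w, k) = X j k" if "k < d" for k
      unfolding X_def by (rule agree[OF ij(2) _ _ w(2) r[OF ij(2)] that])
    then show "a i j = (\<Sum>k<d. (moment_pt i k - moment_pt j k) * X j k)"
      using a[OF ij, of w] w(1) by simp
  qed
  have "(\<Sum>k<d. (moment_pt i k - moment_pt j k) * (X i k - X j k)) = 0" if "i < 2 * d" "j < 2 * d" for i j
  proof (cases "i = j")
    case False
    show ?thesis using aX[OF that False] by (simp add: right_diff_distrib sum_subtractf)
  qed simp
  then obtain A b where Ab: "skew d A" "\<forall>i<2 * d. \<forall>l<d. X i l = affine_skew d A b (moment_pt i) l"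
    using complete_moment_framework[of d "2 * d" X] assms(1) by auto
  have "u (v, k) = X (c v) k" if v: "v \<in> W" and k: "k < d" for v k
  proof -
    let ?S = "{j. j < 2 * d \<and> j \<noteq> c v \<and> v \<in> T (c v) j}"
    have "u (v, k) - X (c v) k = 0"
    proof (rule moment_general_position[of ?S d "c v" "\<lambda>k. u (v, k) - X (c v) k"])
      show "(\<Sum>k<d. (moment_pt (c v) k - moment_pt j k) * (u (v, k) - X (c v) k)) = 0" if "j \<in> ?S" for j
        using that a[of "c v" j v] aX(1)[of "c v" j] c[OF v] by (simp add: right_diff_distrib sum_subtractf)
    qed (use many[OF v] k in auto)
    then show ?thesis by simp
  qed
  then have "\<forall>v\<in>W. \<forall>k<d. u (v, k) = affine_skew d A b (\<lambda>k. clustered c (v, k)) k"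
    using Ab(2) c by (simp add: clustered_def)
  then show ?thesis unfolding trivial_motion_def using Ab(1) by blast
qed

section \<open>Giant bipartite components\<close>

lemma sum_card_swap:
  assumes "finite A" "finite B"
  shows "(\<Sum>a\<in>A. card {b \<in> B. P a b}) = (\<Sum>b\<in>B. card {a \<in> A. P a b})"
proof -
  have "(\<Sum>a\<in>A. card {b \<in> B. P a b}) = (\<Sum>a\<in>A. \<Sum>b\<in>B. of_bool (P a b))"
    using assms(2) by (simp add: Collect_conj_eq Int_commute)
  also have "\<dots> = (\<Sum>b\<in>B. \<Sum>a\<in>A. of_bool (P a b))" by (rule sum.swap)
  also have "\<dots> = (\<Sum>b\<in>B. card {a \<in> A. P a b})"
    using assms(1) by (simp add: Collect_conj_eq Int_commute)
  finally show ?thesis .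
qed

text \<open>The constants form a budget: of \<open>7 * \<kappa>\<close> vertices per class fewer
  than \<open>2 * \<kappa>\<close> are removed, and each \<open>T i j\<close> misses fewer than
  \<kappa> of those left. More than \<open>4 * \<kappa>\<close> stay, which the averaging in
  \<open>excellent_exists\<close> uses up.\<close>

locale coloured_joined =
  fixes V :: "'a set" and E :: "('a \<times> 'a) set" and c :: "'a \<Rightarrow> nat" and d :: nat and \<kappa> :: real
  assumes d: "0 < d" and \<kappa>: "1 \<le> \<kappa>" and finV: "finite V"
    and c: "\<And>v. v \<in> V \<Longrightarrow> c v < 2 * d"
    and big: "\<And>i. i < 2 * d \<Longrightarrow> 7 * \<kappa> \<le> card {v \<in> V. c v = i}"
    and sym: "\<And>v w. (v, w) \<in> E \<Longrightarrow> (w, v) \<in> E"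
    and joined: "\<And>A B. A \<subseteq> V \<Longrightarrow> B \<subseteq> V \<Longrightarrow> A \<inter> B = {} \<Longrightarrow> \<kappa> \<le> card A \<Longrightarrow> \<kappa> \<le> card B \<Longrightarrow>
       \<exists>a\<in>A. \<exists>b\<in>B. (a, b) \<in> E"
begin

text \<open>
  \<open>T i j\<close> plays the role of the colour-\<open>i\<close> side of a giant component of the bipartite graph between
  the colours \<open>i\<close> and \<open>j\<close> inside \<open>W\<close>; every vertex outside \<open>W\<close> misses at least \<open>d\<close> of them.
\<close>

definition admissible :: "'a set \<Rightarrow> (nat \<Rightarrow> nat \<Rightarrow> 'a set) \<Rightarrow> bool" where
  "admissible W T \<longleftrightarrow> W \<subseteq> V \<and>
     (\<forall>i<2 * d. \<forall>j<2 * d. i \<noteq> j \<longrightarrow> T i j \<subseteq> {v \<in> W. c v = i} \<and> \<kappa> \<le> card (T i j) \<and>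
        (\<forall>v\<in>T i j. \<forall>w\<in>W. c w = j \<longrightarrow> (v, w) \<in> E \<longrightarrow> w \<in> T j i)) \<and>
     (\<forall>v\<in>V - W. d \<le> card {j \<in> {..<2 * d} - {c v}. \<forall>w\<in>T j (c v). (w, v) \<notin> E})"

text \<open>The potential to be minimised. At a minimum neither a set \<open>T i j\<close> nor
  \<open>W\<close> can shrink, which replaces the explicit construction of giant components and the
  iterative removal of bad vertices.\<close>

definition weight :: "'a set \<Rightarrow> (nat \<Rightarrow> nat \<Rightarrow> 'a set) \<Rightarrow> nat" where
  "weight W T = card W + (\<Sum>i<2 * d. \<Sum>j\<in>{..<2 * d} - {i}. card (T i j))"

lemma card_unjoined:
  assumes "A \<subseteq> V" "B \<subseteq> V" "A \<inter> B = {}" "\<kappa> \<le> card A" "\<And>a b. a \<in> A \<Longrightarrow> b \<in> B \<Longrightarrow> (a, b) \<notin> E"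
  shows "card B < \<kappa>"
  using joined[OF assms(1-4)] assms(5) by force

lemma admissible_init: "admissible V (\<lambda>i j. {v \<in> V. c v = i})"
  unfolding admissible_def using big \<kappa> by (force simp: sym)

section \<open>Size estimates for an arbitrary admissible pair\<close>

context
  fixes W T assumes adm: "admissible W T"
begin

lemma W: "W \<subseteq> V"
  using adm by (simp add: admissible_def)

lemma finW: "finite W"
  using finite_subset[OF W finV] .

lemma T:
  assumes "i < 2 * d" "j < 2 * d" "i \<noteq> j"
  shows "T i j \<subseteq> {v \<in> W. c v = i}" "T i j \<subseteq> V" "finite (T i j)" "\<kappa> \<le> card (T i j)"
    and "\<And>v w. v \<in> T i j \<Longrightarrow> w \<in> W \<Longrightarrow> c w = j \<Longrightarrow> (v, w) \<in> E \<Longrightarrow> w \<in> T j i"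
proof -
  show 1: "T i j \<subseteq> {v \<in> W. c v = i}" "\<kappa> \<le> card (T i j)"
    "\<And>v w. v \<in> T i j \<Longrightarrow> w \<in> W \<Longrightarrow> c w = j \<Longrightarrow> (v, w) \<in> E \<Longrightarrow> w \<in> T j i"
    using adm assms unfolding admissible_def by auto
  show "T i j \<subseteq> V" using 1(1) W by auto
  then show "finite (T i j)" using finV finite_subset by auto
qed

text \<open>Double counting of pairs of a removed vertex \<open>v\<close> and a colour
  \<open>j\<close> such that \<open>T j i\<close> sends no edge to \<open>v\<close>. Each
  \<open>v\<close> has at least \<open>d\<close> such colours, each of the \<open>2 * d - 1\<close>
  colours serves fewer than \<kappa> vertices, and
  \<open>(2 * d - 1) * \<kappa> < 2 * \<kappa> * d\<close>.\<close>

lemma card_removed: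
  assumes i: "i < 2 * d"
  shows "card {v \<in> V - W. c v = i} < 2 * \<kappa>"
proof -
  let ?D = "{v \<in> V - W. c v = i}" and ?J = "{..<2 * d} - {i}"
  let ?P = "\<lambda>v j. \<forall>w\<in>T j i. (w, v) \<notin> E"
  have fin: "finite ?D" using finV by simp
  have "d \<le> card {j \<in> ?J. ?P v j}" if "v \<in> ?D" for v
    using that adm unfolding admissible_def by auto
  then have "(\<Sum>v\<in>?D. d) \<le> (\<Sum>v\<in>?D. card {j \<in> ?J. ?P v j})" by (rule sum_mono)
  also have "\<dots> = (\<Sum>j\<in>?J. card {v \<in> ?D. ?P v j})" by (rule sum_card_swap[OF fin]) simp
  finally have "real (card ?D * d) \<le> (\<Sum>j\<in>?J. real (card {v \<in> ?D. ?P v j}))"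
    by (simp flip: of_nat_sum of_nat_mult)
  also have "\<dots> \<le> (\<Sum>j\<in>?J. \<kappa>)"
  proof (rule sum_mono)
    fix j assume j: "j \<in> ?J"
    have "card {v \<in> ?D. ?P v j} < \<kappa>"
      by (rule card_unjoined[of "T j i"]) (use j i T[of j i] in auto)
    then show "card {v \<in> ?D. ?P v j} \<le> \<kappa>" by simp
  qed
  also have "\<dots> = (2 * real d - 1) * \<kappa>" using i d by (simp add: of_nat_diff)
  also have "\<dots> < (2 * \<kappa>) * d" using \<kappa> by (simp add: algebra_simps)
  finally show ?thesis using d by simp
qed

lemma card_class:
  assumes "i < 2 * d"
  shows "5 * \<kappa> < card {v \<in> W. c v = i}"
proof -
  have "{v \<in> V. c v = i} = {v \<in> W. c v = i} \<union> {v \<in> V - W. c v = i}" using W by auto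
  then have "card {v \<in> V. c v = i} = card ({v \<in> W. c v = i} \<union> {v \<in> V - W. c v = i})"
    by (rule arg_cong)
  also have "\<dots> \<le> card {v \<in> W. c v = i} + card {v \<in> V - W. c v = i}" by (rule card_Un_le)
  finally have "card {v \<in> V. c v = i} \<le> card {v \<in> W. c v = i} + card {v \<in> V - W. c v = i}" .
  then show ?thesis using card_removed[OF assms] big[OF assms] by linarith
qed

text \<open>By the closure condition, \<open>T j i\<close> sends no edge to the missed vertices, and
  it has at least \<kappa> elements.\<close>

lemma card_missed:
  assumes ij: "i < 2 * d" "j < 2 * d" "i \<noteq> j"
  shows "card ({v \<in> W. c v = i} - T i j) < \<kappa>"
proof (rule card_unjoined[of "T j i"])
  show "(a, b) \<notin> E" if "a \<in> T j i" "b \<in> {v \<in> W. c v = i} - T i j" for a b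
    using that T(5)[of j i a b] ij by auto
qed (use T[of j i] ij W in auto)

lemma card_T:
  assumes ij: "i < 2 * d" "j < 2 * d" "i \<noteq> j"
  shows "4 * \<kappa> < card (T i j)"
proof -
  have "card {v \<in> W. c v = i} - card (T i j) = card ({v \<in> W. c v = i} - T i j)"
    using T[OF ij] by (simp add: card_Diff_subset)
  then show ?thesis using card_missed[OF ij] card_class[OF ij(1)] by linarith
qed

text \<open>If every vertex of \<open>T i j\<close> missed at least \<open>d / 2\<close> colours,
  double counting against \<open>card_missed\<close> would give \<open>T i j\<close> fewer than
  \<open>4 * \<kappa>\<close> elements.\<close>

lemma excellent_exists:
  assumes ij: "i < 2 * d" "j < 2 * d" "i \<noteq> j"
  shows "\<exists>v\<in>T i j. 2 * card {j. j < 2 * d \<and> j \<noteq> i \<and> v \<notin> T i j} < d"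
proof (rule ccontr)
  assume none: "\<not> ?thesis"
  let ?J = "{..<2 * d} - {i}"
  have J: "{j. j < 2 * d \<and> j \<noteq> i \<and> v \<notin> T i j} = {j \<in> ?J. v \<notin> T i j}" for v by auto
  have "(\<Sum>v\<in>T i j. d) \<le> (\<Sum>v\<in>T i j. 2 * card {j \<in> ?J. v \<notin> T i j})"
    using none unfolding J by (intro sum_mono) (simp add: not_less)
  also have "\<dots> = 2 * (\<Sum>k\<in>?J. card {v \<in> T i j. v \<notin> T i k})"
    unfolding sum_distrib_left[symmetric] using T[OF ij] by (subst sum_card_swap) auto
  finally have "real (card (T i j) * d) \<le> 2 * (\<Sum>k\<in>?J. real (card {v \<in> T i j. v \<notin> T i k}))"
    by (simp flip: of_nat_sum of_nat_mult)
  also have "\<dots> \<le> 2 * (\<Sum>k\<in>?J. \<kappa>)"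
  proof (intro mult_left_mono sum_mono)
    fix k assume k: "k \<in> ?J"
    have "card {v \<in> T i j. v \<notin> T i k} \<le> card ({v \<in> W. c v = i} - T i k)"
      by (rule card_mono) (use finW T(1)[OF ij] in auto)
    then show "real (card {v \<in> T i j. v \<notin> T i k}) \<le> \<kappa>" using card_missed[of i k] k ij by auto
  qed simp
  also have "\<dots> = 2 * (2 * real d - 1) * \<kappa>" using ij d by (simp add: of_nat_diff)
  also have "\<dots> < (4 * \<kappa>) * d" using \<kappa> by (simp add: algebra_simps)
  finally have "card (T i j) < 4 * \<kappa>" using d by simp
  then show False using card_T[OF ij] by simp
qed

section \<open>Consequences of minimal weight\<close>

context
  assumes minimal: "\<And>W' T'. admissible W' T' \<Longrightarrow> weight W T \<le> weight W' T'"
begin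

text \<open>\<open>A\<close> and \<open>B\<close> form a union of components between
  \<open>T i j\<close> and \<open>T j i\<close>. Since \<open>A\<close> is large, few vertices of
  colour \<open>j\<close> avoid \<open>B\<close>, so \<open>B\<close> is large too. Replacing the
  pair by \<open>A\<close> and \<open>B\<close> keeps admissibility, because smaller sets join a
  removed vertex to fewer colours; minimality then excludes a proper part.\<close>

lemma closed_part_eq:
  assumes ij: "i < 2 * d" "j < 2 * d" "i \<noteq> j"
    and A: "A \<subseteq> T i j" "B \<subseteq> T j i" "\<kappa> \<le> card A"
    and closed: "\<And>v w. v \<in> T i j \<Longrightarrow> w \<in> T j i \<Longrightarrow> (v, w) \<in> E \<Longrightarrow> v \<in> A \<longleftrightarrow> w \<in> B"
  shows "A = T i j \<and> B = T j i"
proof -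
  have Tij: "T i j \<subseteq> {v \<in> W. c v = i}" "T j i \<subseteq> {v \<in> W. c v = j}" "finite (T i j)" "finite (T j i)"
    using T[of i j] T[of j i] ij by auto
  have closed1: "w \<in> B" if "v \<in> A" "w \<in> W" "c w = j" "(v, w) \<in> E" for v w
    using that A(1) closed[of v w] T(5)[OF ij, of v w] by auto
  have closed2: "v \<in> A" if "w \<in> B" "v \<in> W" "c v = i" "(w, v) \<in> E" for v w
    using that A(2) closed[of v w] T(5)[of j i w v] ij sym by auto
  have "card ({v \<in> W. c v = j} - B) < \<kappa>"
    by (rule card_unjoined[of A]) (use A closed1 Tij W ij in auto)
  moreover have "card {v \<in> W. c v = j} - card B = card ({v \<in> W. c v = j} - B)"
    using A(2) Tij finite_subset[OF A(2)] by (subst card_Diff_subset) auto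
  ultimately have cB: "\<kappa> \<le> card B" using card_class[OF ij(2)] \<kappa> by linarith
  define T' where "T' = (\<lambda>k l. if k = i \<and> l = j then A else if k = j \<and> l = i then B else T k l)"
  have sub: "T' k l \<subseteq> T k l" for k l using A unfolding T'_def by auto
  have "admissible W T'"
    unfolding admissible_def
  proof (intro conjI allI impI ballI)
    show "W \<subseteq> V" by (rule W)
    fix k l assume kl: "k < 2 * d" "l < 2 * d" "k \<noteq> l"
    show "T' k l \<subseteq> {v \<in> W. c v = k}" using sub[of k l] T(1)[OF kl] by auto
    show "\<kappa> \<le> card (T' k l)" using A(3) cB T(4)[OF kl] unfolding T'_def by auto
    fix v w assume "v \<in> T' k l" "w \<in> W" "c w = l" "(v, w) \<in> E"
    then show "w \<in> T' l k" using closed1[of v w] closed2[of v w] T(5)[OF kl, of v w] ij(3)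
      unfolding T'_def by (auto split: if_splits)
  next
    fix v assume v: "v \<in> V - W"
    have "card {j \<in> {..<2 * d} - {c v}. \<forall>w\<in>T j (c v). (w, v) \<notin> E}
       \<le> card {j \<in> {..<2 * d} - {c v}. \<forall>w\<in>T' j (c v). (w, v) \<notin> E}"
      using sub by (intro card_mono) auto
    then show "d \<le> card {j \<in> {..<2 * d} - {c v}. \<forall>w\<in>T' j (c v). (w, v) \<notin> E}"
      using v adm unfolding admissible_def by (auto intro: order_trans)
  qed
  then have le: "weight W T \<le> weight W T'" by (rule minimal)
  show ?thesis
  proof (rule ccontr)
    assume ne: "\<not> ?thesis"
    have cle: "card (T' k l) \<le> card (T k l)" if "k < 2 * d" "l < 2 * d" "k \<noteq> l" for k l
      using sub T(3)[OF that] by (intro card_mono) auto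
    have "\<exists>k l. k < 2 * d \<and> l < 2 * d \<and> k \<noteq> l \<and> card (T' k l) < card (T k l)"
    proof (cases "A = T i j")
      case True
      then have "B \<subset> T j i" using ne A(2) by auto
      then have "card (T' j i) < card (T j i)"
        using Tij(4) ij(3) by (auto simp: T'_def intro: psubset_card_mono)
      then show ?thesis using ij by metis
    next
      case False
      then have "A \<subset> T i j" using A(1) by auto
      then have "card (T' i j) < card (T i j)"
        using Tij(3) by (auto simp: T'_def intro: psubset_card_mono)
      then show ?thesis using ij by metis
    qed
    then obtain k l where kl: "k < 2 * d" "l < 2 * d" "k \<noteq> l" "card (T' k l) < card (T k l)" by auto
    have "weight W T' < weight W T"
      unfolding weight_def
      by (intro add_strict_left_mono sum_strict_mono_ex1 sum_mono ballI bexI[of _ k] bexI[of _ l])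
         (use cle kl in auto)
    then show False using le by simp
  qed
qed

text \<open>The level set of \<phi> through a chosen vertex and its complement are both closed under
  edges. One of them has at least \<kappa> vertices in \<open>T i j\<close> and is therefore
  everything, and it must be the one containing that vertex.\<close>

lemma T_connected:
  fixes \<phi> :: "'a \<Rightarrow> real"
  assumes ij: "i < 2 * d" "j < 2 * d" "i \<noteq> j"
    and \<phi>: "\<And>v w. v \<in> T i j \<Longrightarrow> w \<in> T j i \<Longrightarrow> (v, w) \<in> E \<Longrightarrow> \<phi> v = \<phi> w"
  shows "\<exists>a. \<forall>v\<in>T i j \<union> T j i. \<phi> v = a"
proof -
  have "T i j \<noteq> {}" using T(4)[OF ij] \<kappa> by auto
  then obtain v0 where v0: "v0 \<in> T i j" by auto
  let ?A = "\<lambda>S. {v \<in> S. \<phi> v = \<phi> v0}" and ?B = "\<lambda>S. {v \<in> S. \<phi> v \<noteq> \<phi> v0}"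
  have "T i j = ?A (T i j) \<union> ?B (T i j)" by auto
  then have "card (T i j) = card (?A (T i j) \<union> ?B (T i j))" by (rule arg_cong)
  also have "\<dots> \<le> card (?A (T i j)) + card (?B (T i j))" by (rule card_Un_le)
  finally have "card (T i j) \<le> card (?A (T i j)) + card (?B (T i j))" .
  then have "\<kappa> \<le> card (?A (T i j)) \<or> \<kappa> \<le> card (?B (T i j))" using card_T[OF ij] \<kappa> by linarith
  then have "?A (T i j) = T i j \<and> ?A (T j i) = T j i \<or> ?B (T i j) = T i j \<and> ?B (T j i) = T j i"
    using closed_part_eq[OF ij, of "?A (T i j)" "?A (T j i)"] closed_part_eq[OF ij, of "?B (T i j)" "?B (T j i)"] \<phi>
    by auto
  then have "?A (T i j) = T i j \<and> ?A (T j i) = T j i" using v0 by auto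
  then show ?thesis by (intro exI[of _ "\<phi> v0"]) auto
qed

text \<open>A vertex lying in too few sets \<open>T (c v) j\<close> could be deleted from
  \<open>W\<close> and from all \<open>T k l\<close>, lowering the weight.\<close>

lemma T_many:
  assumes v: "v \<in> W"
  shows "d \<le> card {j. j < 2 * d \<and> j \<noteq> c v \<and> v \<in> T (c v) j}"
proof (rule ccontr)
  assume few: "\<not> ?thesis"
  define T' where "T' = (\<lambda>k l. T k l - {v})"
  have cv: "c v < 2 * d" using v W c by auto
  have "admissible (W - {v}) T'"
    unfolding admissible_def
  proof (intro conjI allI impI ballI)
    show "W - {v} \<subseteq> V" using W by auto
    fix k l assume kl: "k < 2 * d" "l < 2 * d" "k \<noteq> l"
    show "T' k l \<subseteq> {u \<in> W - {v}. c u = k}" using T(1)[OF kl] unfolding T'_def by auto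
    \<comment> \<open>The surplus over \<kappa> given by \<open>card_T\<close> absorbs the loss of
      one vertex.\<close>
    have "card (T k l) - 1 \<le> card (T' k l)" unfolding T'_def by (simp add: card_Diff_singleton_if)
    then show "\<kappa> \<le> card (T' k l)" using card_T[OF kl] \<kappa> by linarith
    fix a b assume "a \<in> T' k l" "b \<in> W - {v}" "c b = l" "(a, b) \<in> E"
    then show "b \<in> T' l k" using T(5)[OF kl, of a b] unfolding T'_def by auto
  next
    fix u assume u: "u \<in> V - (W - {v})"
    let ?S = "\<lambda>T. {j \<in> {..<2 * d} - {c u}. \<forall>w\<in>T j (c u). (w, u) \<notin> E}"
    have mono: "card (?S T) \<le> card (?S T')" unfolding T'_def by (intro card_mono) auto
    show "d \<le> card (?S T')"
    proof (cases "u = v")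
      case False
      then have "d \<le> card (?S T)" using u adm unfolding admissible_def by auto
      then show ?thesis using mono by simp
    next
      case True
      let ?G = "{j. j < 2 * d \<and> j \<noteq> c v \<and> v \<in> T (c v) j}"
      \<comment> \<open>A neighbour of \<open>v\<close> in \<open>T j (c v)\<close> would put
        \<open>v\<close> into \<open>T (c v) j\<close> by closure. So \<open>v\<close> is unjoined
        to every colour it misses; there are at least \<open>(2 * d - 1) - (d - 1) = d\<close> of
        these.\<close>
      have "({..<2 * d} - {c v}) - ?G \<subseteq> ?S T"
      proof
        fix j assume j: "j \<in> ({..<2 * d} - {c v}) - ?G"
        then have "(w, v) \<notin> E" if "w \<in> T j (c v)" for w
          using T(5)[of j "c v" w v] that v cv by auto
        then show "j \<in> ?S T" using j True by auto
      qed
      then have "card (({..<2 * d} - {c v}) - ?G) \<le> card (?S T)" by (intro card_mono) auto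
      moreover have "card (({..<2 * d} - {c v}) - ?G) = 2 * d - 1 - card ?G"
        using cv by (subst card_Diff_subset) auto
      ultimately show ?thesis using few mono by linarith
    qed
  qed
  then have le: "weight W T \<le> weight (W - {v}) T'" by (rule minimal)
  have "card (W - {v}) < card W" using v finW by (intro psubset_card_mono) auto
  moreover have "(\<Sum>i<2 * d. \<Sum>j\<in>{..<2 * d} - {i}. card (T' i j)) \<le> (\<Sum>i<2 * d. \<Sum>j\<in>{..<2 * d} - {i}. card (T i j))"
    unfolding T'_def using T(3) by (intro sum_mono card_mono) auto
  ultimately show False using le unfolding weight_def by linarith
qed

end

end

lemma exists_minimal:
  obtains W T where "admissible W T" "\<And>W' T'. admissible W' T' \<Longrightarrow> weight W T \<le> weight W' T'"
proof -
  obtain z where z: "case_prod admissible z" "\<forall>z'. case_prod admissible z' \<longrightarrow> case_prod weight z \<le> case_prod weight z'"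
    using ex_has_least_nat[of "case_prod admissible" "(V, \<lambda>i j. {v \<in> V. c v = i})" "case_prod weight"]
      admissible_init by auto
  show ?thesis by (rule that[of "fst z" "snd z"]) (use z in \<open>auto simp: case_prod_beta\<close>)
qed

end

section \<open>Rigidity of expanders\<close>

lemma trivial_motion_edge:
  assumes "trivial_motion d V y u" "finite V" "v \<in> V" "w \<in> V"
  shows "ip (V \<times> {..<d}) (edge_row y (v, w)) u = 0"
proof -
  obtain A b where A: "skew d A" "\<And>v i. v \<in> V \<Longrightarrow> i < d \<Longrightarrow> u (v, i) = affine_skew d A b (\<lambda>k. y (v, k)) i"
    using assms(1) unfolding trivial_motion_def by auto
  show ?thesis
    using affine_skew_edge[OF A(1), of "\<lambda>k. y (v, k)" "\<lambda>k. y (w, k)" b]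
    unfolding ip_edge_row[OF assms(2-4)] by (simp add: A(2) assms(3,4))
qed

text \<open>
  Rows spanning the trivial motions. Reading the coordinate \<open>d\<close> of every point as \<open>1\<close>, the row
  \<open>(k, d)\<close> is a translation and the row \<open>(k, l)\<close> with \<open>l < d\<close> is a rotation.
\<close>

definition hcoord :: "nat \<Rightarrow> ('a \<times> nat \<Rightarrow> real) \<Rightarrow> 'a \<Rightarrow> nat \<Rightarrow> real" where
  "hcoord d y v l = (if l = d then 1 else y (v, l))"

definition triv_row :: "nat \<Rightarrow> ('a \<times> nat \<Rightarrow> real) \<Rightarrow> nat \<times> nat \<Rightarrow> 'a \<times> nat \<Rightarrow> real" where
  "triv_row d y e x = of_bool (snd x = fst e) * hcoord d y (fst x) (snd e)
     - of_bool (snd x = snd e) * hcoord d y (fst x) (fst e)"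

lemma triv_row_combination:
  assumes "i < d"
  shows "(\<Sum>e\<in>{..<d} \<times> {..d}. g e * triv_row d y e (v, i))
    = affine_skew d (\<lambda>i k. g (i, k) - g (k, i)) (\<lambda>i. g (i, d)) (\<lambda>k. y (v, k)) i"
proof -
  have "(\<Sum>e\<in>{..<d} \<times> {..d}. g e * triv_row d y e (v, i))
      = (\<Sum>k<d. \<Sum>l\<le>d. of_bool (i = k) * (g (k, l) * hcoord d y v l))
        - (\<Sum>k<d. \<Sum>l\<le>d. of_bool (i = l) * (g (k, l) * hcoord d y v k))"
    by (simp add: sum.cartesian_product' triv_row_def right_diff_distrib sum_subtractf mult_ac)
  also have "(\<Sum>k<d. \<Sum>l\<le>d. of_bool (i = k) * (g (k, l) * hcoord d y v l))
      = (\<Sum>k<d. of_bool (i = k) * (\<Sum>l\<le>d. g (k, l) * hcoord d y v l))"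
    by (simp add: sum_distrib_left)
  also have "\<dots> = (\<Sum>l\<le>d. g (i, l) * hcoord d y v l)"
    using assms by (simp add: of_bool_def if_distrib[of "\<lambda>t. t * _"] cong: if_cong)
  also have "\<dots> = (\<Sum>l<d. g (i, l) * y (v, l)) + g (i, d)"
    by (simp add: hcoord_def flip: lessThan_Suc_atMost)
  also have "(\<Sum>k<d. \<Sum>l\<le>d. of_bool (i = l) * (g (k, l) * hcoord d y v k)) = (\<Sum>k<d. g (k, i) * y (v, k))"
    using assms by (intro sum.cong refl) (simp add: hcoord_def of_bool_def if_distrib[of "\<lambda>t. t * _"] cong: if_cong)
  finally show ?thesis
    by (simp add: affine_skew_def left_diff_distrib sum_subtractf)
qed

lemma triv_row_combination_trivial:
  assumes "\<And>x. x \<in> V \<times> {..<d} \<Longrightarrow> u x = (\<Sum>e\<in>{..<d} \<times> {..d}. g e * triv_row d y e x)"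
  shows "trivial_motion d V y u"
  unfolding trivial_motion_def
proof (intro exI conjI ballI allI impI)
  show "skew d (\<lambda>i k. g (i, k) - g (k, i))" by (simp add: skew_def)
  show "u (v, i) = affine_skew d (\<lambda>i k. g (i, k) - g (k, i)) (\<lambda>i. g (i, d)) (\<lambda>k. y (v, k)) i"
    if "v \<in> V" "i < d" for v i
    using assms[of "(v, i)"] that triv_row_combination[OF that(2), of g y v] by simp
qed

lemma trivial_motion_orthogonal:
  assumes "finite V" "trivial_motion d V y u"
    and orth: "\<And>e. e \<in> {..<d} \<times> {..d} \<Longrightarrow> ip (V \<times> {..<d}) (triv_row d y e) u = 0"
  shows "\<forall>x\<in>V \<times> {..<d}. u x = 0"
proof -
  obtain A b where A: "skew d A" "\<And>v i. v \<in> V \<Longrightarrow> i < d \<Longrightarrow> u (v, i) = affine_skew d A b (\<lambda>k. y (v, k)) i"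
    using assms(2) unfolding trivial_motion_def by auto
  \<comment> \<open>The rows \<open>(k, l)\<close> and \<open>(l, k)\<close> are opposite rotations,
    so each carries half of the skew matrix entry.\<close>
  define g where "g = (\<lambda>(k, l). if l = d then b k else A k l / 2)"
  have "u (v, i) = (\<Sum>e\<in>{..<d} \<times> {..d}. g e * triv_row d y e (v, i))" if "v \<in> V" "i < d" for v i
  proof -
    have "A i k = A i k / 2 - A k i / 2" if "k < d" for k
      using A(1) \<open>i < d\<close> that unfolding skew_def by (metis field_sum_of_halves minus_divide_left diff_minus_eq_add)
    then show ?thesis
      unfolding triv_row_combination[OF that(2)] A(2)[OF that]
      using that(2) by (simp add: affine_skew_def g_def)
  qed
  then have "ip (V \<times> {..<d}) u u = ip (V \<times> {..<d}) (\<lambda>x. \<Sum>e\<in>{..<d} \<times> {..d}. g e * triv_row d y e x) u"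
    unfolding ip_def by (intro sum.cong refl) auto
  also have "\<dots> = 0" unfolding ip_sum_left using orth by simp
  finally show ?thesis using ip_self_eq_0_iff[of "V \<times> {..<d}" u] assms(1) by simp
qed

text \<open>The edge rows always have the trivial motions in their kernel, so
  \<open>trivial_kernel_generic\<close> is applied to the edge rows together with the rows spanning
  the trivial motions. It shows that \<open>u\<close> minus its projection \<open>t\<close> onto the
  trivial motions vanishes.\<close>

lemma generic_motions_trivial:
  assumes V: "finite V" and E: "E \<subseteq> V \<times> V"
    and gen: "alg_independent (V \<times> {..<d}) y"
    and special: "\<And>u. (\<And>e. e \<in> E \<Longrightarrow> ip (V \<times> {..<d}) (edge_row z e) u = 0) \<Longrightarrow> trivial_motion d V z u"
    and u: "\<And>e. e \<in> E \<Longrightarrow> ip (V \<times> {..<d}) (edge_row y e) u = 0"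
  shows "trivial_motion d V y u"
proof -
  let ?I = "V \<times> {..<d}" and ?R = "{..<d} \<times> {..d}"
  have I: "finite ?I" and R: "finite ?R" and finE: "finite E"
    using V E by (auto intro: finite_subset)
  obtain g where g: "\<And>e. e \<in> ?R \<Longrightarrow> ip ?I (triv_row d y e) (\<lambda>x. u x - (\<Sum>f\<in>?R. g f * triv_row d y f x)) = 0"
    using orthogonal_decomposition[OF I R, of "triv_row d y" u] by auto
  define t where "t = (\<lambda>x. \<Sum>f\<in>?R. g f * triv_row d y f x)"
  have t: "trivial_motion d V y t"
    by (rule triv_row_combination_trivial[of V d t g y]) (simp add: t_def)
  have ut: "\<forall>x\<in>?I. u x - t x = 0"
  proof (rule trivial_kernel_generic[OF I _ _ gen, of "E <+> ?R" "\<lambda>y. case_sum (edge_row y) (triv_row d y)" z])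
    show "polyfun ?I (\<lambda>y. case_sum (edge_row y) (triv_row d y) k x)" if "k \<in> E <+> ?R" "x \<in> ?I" for k x
    proof (cases k)
      case (Inl e)
      then have "e \<in> E" using that(1) by auto
      then obtain v w where "e = (v, w)" "v \<in> V" "w \<in> V" using E by (cases e) auto
      then show ?thesis using Inl that(2) by (simp add: polyfun_edge_row)
    next
      case (Inr e)
      then have "e \<in> ?R" using that(1) by auto
      then obtain k l where e: "e = (k, l)" "k < d" "l \<le> d" by auto
      have h: "polyfun ?I (\<lambda>y. hcoord d y (fst x) l)" if "l \<le> d" for l
        using that \<open>x \<in> ?I\<close> by (cases "l = d") (auto simp: hcoord_def intro!: polyfun_var)
      have "polyfun ?I (\<lambda>y. of_int (of_bool (snd x = k)) * hcoord d y (fst x) l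
          - of_int (of_bool (snd x = l)) * hcoord d y (fst x) k)"
        using e by (intro polyfun_diff polyfun_mult polyfun_of_int h) auto
      then show ?thesis using Inr e by (simp add: triv_row_def)
    qed
    show "\<forall>x\<in>?I. v x = 0" if v: "\<And>k. k \<in> E <+> ?R \<Longrightarrow> ip ?I (case_sum (edge_row z) (triv_row d z) k) v = 0" for v
    proof (rule trivial_motion_orthogonal[OF V])
      show "trivial_motion d V z v" by (rule special) (use v[OF InlI] in simp)
      show "ip ?I (triv_row d z e) v = 0" if "e \<in> ?R" for e using v[OF InrI[OF that]] by simp
    qed
    show "ip ?I (case_sum (edge_row y) (triv_row d y) k) (\<lambda>x. u x - t x) = 0" if "k \<in> E <+> ?R" for k
    proof (cases k)
      case (Inl e)
      then have "e \<in> E" using that by auto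
      then obtain v w where e: "e = (v, w)" "v \<in> V" "w \<in> V" "e \<in> E" using E by (cases e) auto
      have "ip ?I (edge_row y e) t = 0" unfolding e(1) by (rule trivial_motion_edge[OF t V e(2,3)])
      then show ?thesis using Inl u[OF e(4)] by (simp add: ip_diff_right)
    next
      case (Inr e)
      then show ?thesis using g[of e] that by (auto simp: t_def)
    qed
  qed (use finE R in simp)
  have "u x = (\<Sum>f\<in>?R. g f * triv_row d y f x)" if "x \<in> ?I" for x
    using bspec[OF ut that] by (simp add: t_def)
  then show ?thesis by (rule triv_row_combination_trivial)
qed

lemma generic_general_position:
  assumes gen: "alg_independent (V \<times> {..<d}) y"
    and S: "S \<subseteq> V" "finite S" "card S = d" and v: "v \<in> V" "v \<notin> S"
    and u: "\<And>w. w \<in> S \<Longrightarrow> (\<Sum>i<d. (y (v, i) - y (w, i)) * u i) = 0"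
  shows "\<forall>i<d. u i = 0"
proof -
  obtain h where h: "bij_betw h S {..<d}" using S by (metis finite_same_card_bij card_lessThan finite_lessThan)
  \<comment> \<open>The special placement puts the points of \<open>S\<close> at the unit vectors
    and \<open>v\<close> at the origin.\<close>
  let ?z = "\<lambda>(x, i). of_bool (x \<in> S \<and> h x = i) :: real"
  have "\<forall>i\<in>{..<d}. u i = 0"
  proof (rule trivial_kernel_generic[where I = "{..<d}" and r = "\<lambda>y w i. y (v, i) - y (w, i)" and ?z0.0 = ?z,
        OF finite_lessThan S(2) _ gen])
    show "polyfun (V \<times> {..<d}) (\<lambda>y. y (v, i) - y (w, i))" if "w \<in> S" "i \<in> {..<d}" for w i
      using that S(1) v(1) by (intro polyfun_diff polyfun_var) auto
    show "\<forall>i\<in>{..<d}. x i = 0" if x: "\<And>w. w \<in> S \<Longrightarrow> ip {..<d} (\<lambda>i. ?z (v, i) - ?z (w, i)) x = 0" for x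
    proof
      fix i assume i: "i \<in> {..<d}"
      then have "i \<in> h ` S" using h by (simp add: bij_betw_def)
      then obtain w where w: "w \<in> S" "h w = i" by auto
      have "ip {..<d} (\<lambda>i. ?z (v, i) - ?z (w, i)) x = - x i"
        using v(2) w i by (simp add: ip_def of_bool_def if_distrib[of "\<lambda>t. t * _"] sum_negf cong: if_cong)
      then show "x i = 0" using x[OF w(1)] by simp
    qed
    show "ip {..<d} (\<lambda>i. y (v, i) - y (w, i)) u = 0" if "w \<in> S" for w
      using u[OF that] by (simp add: ip_def)
  qed
  then show ?thesis by simp
qed

text \<open>Hence adding vertices with \<open>d\<close> neighbours, starting from a rigid core of linear size, exhausts the graph.\<close>

lemma expander_exhausted:
  fixes C :: real
  assumes G: "pair_graph G" and exp: "expander C G" and C: "8 * real d \<le> C" and d: "0 < d"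
    and Z: "Z \<subseteq> pverts G" and \<kappa>: "\<kappa> = real (card (pverts G)) / (2 * C)" "1 \<le> \<kappa>"
    and big: "10 * real d * \<kappa> \<le> card Z"
    and few: "\<And>v. v \<in> pverts G - Z \<Longrightarrow> card {w \<in> Z. (v, w) \<in> parcs G} < d"
  shows "Z = pverts G"
proof (rule ccontr)
  assume ne: "Z \<noteq> pverts G"
  let ?V = "pverts G" and ?E = "parcs G"
  interpret pair_graph G by (rule G)
  have finV: "finite ?V" by simp
  have finZ: "finite Z" by (rule finite_subset[OF Z finV])
  define B where "B = ?V - Z"
  have B: "finite B" "B \<noteq> {}" using ne Z finV by (auto simp: B_def)
  have N: "card (\<Union>v\<in>B'. {w \<in> Z. (v, w) \<in> ?E}) \<le> card B' * d" if "B' \<subseteq> B" for B'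
  proof -
    have finB': "finite B'" using that B(1) finite_subset by auto
    have "card (\<Union>v\<in>B'. {w \<in> Z. (v, w) \<in> ?E}) \<le> (\<Sum>v\<in>B'. card {w \<in> Z. (v, w) \<in> ?E})"
      by (rule card_UN_le[OF finB'])
    also have "\<dots> \<le> (\<Sum>v\<in>B'. d)" using few that by (intro sum_mono less_imp_le) (auto simp: B_def)
    finally show ?thesis by simp
  qed
  show False
  proof (cases "real (card B) < \<kappa>")
    \<comment> \<open>A small remainder \<open>B\<close> must have at least
      \<open>C * card B\<close> neighbours, all in \<open>Z\<close>, but fewer than \<open>d\<close>
      per vertex are available; this contradicts \<open>8 * d \<le> C\<close>.\<close>
    case True
    then have "C * card B \<le> card (ext_nbhd G B)"
      using exp unfolding expander_def \<kappa>(1) B_def by (meson Diff_subset)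
    also have "ext_nbhd G B = (\<Union>v\<in>B. {w \<in> Z. (v, w) \<in> ?E})"
      using Z by (auto simp: ext_nbhd_def B_def)
    also have "real (card \<dots>) \<le> card B * d" using N[OF subset_refl] by (simp flip: of_nat_mult)
    finally have "C * card B \<le> d * real (card B)" by (simp add: mult.commute)
    then have "C \<le> d" using B by (simp add: card_gt_0_iff)
    then show False using C d by simp
  next
    case False
    \<comment> \<open>Otherwise some \<open>B'\<close> has size \<kappa> rounded up, at most
      \<open>2 * \<kappa>\<close>. Its neighbours use up at most \<open>2 * d * \<kappa>\<close> of
      \<open>Z\<close>, and the rest still has at least \<kappa> vertices, so an edge must join it
      to \<open>B'\<close>.\<close>
    then have "nat \<lceil>\<kappa>\<rceil> \<le> card B" by linarith
    then obtain B' where B': "B' \<subseteq> B" "card B' = nat \<lceil>\<kappa>\<rceil>"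
      by (meson obtain_subset_with_card_n)
    have cB': "\<kappa> \<le> card B'" "real (card B') \<le> 2 * \<kappa>" using B'(2) \<kappa>(2) by linarith+
    let ?N = "\<Union>v\<in>B'. {w \<in> Z. (v, w) \<in> ?E}"
    have "real (card ?N) \<le> real (card B') * d" using N[OF B'(1)] by (simp flip: of_nat_mult)
    also have "\<dots> \<le> 2 * \<kappa> * d" using cB'(2) by (intro mult_right_mono) auto
    finally have "real (card ?N) \<le> 2 * \<kappa> * d" .
    moreover have "card Z - card ?N \<le> card (Z - ?N)" by (rule diff_card_le_card_Diff) (use finZ in \<open>auto intro: finite_subset\<close>)
    moreover have "\<kappa> * 1 \<le> \<kappa> * d" using d \<kappa>(2) by (intro mult_left_mono) auto
    ultimately have "\<kappa> \<le> card (Z - ?N)" using big by (simp add: algebra_simps)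
    moreover have "B' \<subseteq> ?V" "Z - ?N \<subseteq> ?V" "B' \<inter> (Z - ?N) = {}" using B'(1) Z by (auto simp: B_def)
    ultimately have "\<exists>a\<in>B'. \<exists>b\<in>Z - ?N. (a, b) \<in> ?E"
      using conjunct2[OF exp[unfolded expander_def], rule_format, of B' "Z - ?N"] cB'(1)
      unfolding \<kappa>(1) by simp
    then show False by auto
  qed
qed

text \<open>Consecutive blocks of an enumeration serve as colours. Vertices left over by rounding
  may receive a colour of \<open>m\<close> or more.\<close>

lemma balanced_colouring:
  assumes "finite V" "0 < m"
  obtains c :: "'a \<Rightarrow> nat" where "\<And>i. i < m \<Longrightarrow> card V div m \<le> card {v \<in> V. c v = i}"
proof -
  let ?q = "card V div m"
  obtain h where h: "bij_betw h V {0..<card V}"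
    using ex_bij_betw_finite_nat[OF assms(1)] by auto
  show thesis
  proof (rule that[of "\<lambda>v. h v div ?q"])
    fix i assume i: "i < m"
    show "?q \<le> card {v \<in> V. h v div ?q = i}"
    proof (cases "?q = 0")
      case False
      have "{i * ?q..<i * ?q + ?q} \<subseteq> h ` {v \<in> V. h v div ?q = i}"
      proof
        fix x assume x: "x \<in> {i * ?q..<i * ?q + ?q}"
        have "i * ?q + ?q = Suc i * ?q" by simp
        also have "\<dots> \<le> m * ?q" using i by (intro mult_right_mono) auto
        also have "\<dots> \<le> card V" by simp
        finally have "x \<in> {0..<card V}" using x by simp
        then have "x \<in> h ` V" using h by (simp add: bij_betw_def)
        moreover have "x div ?q = i"
          using x by (intro div_nat_eqI) (simp_all add: mult.commute)
        ultimately show "x \<in> h ` {v \<in> V. h v div ?q = i}" by auto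
      qed
      then have "card {i * ?q..<i * ?q + ?q} \<le> card (h ` {v \<in> V. h v div ?q = i})"
        using assms(1) by (intro card_mono) auto
      also have "\<dots> \<le> card {v \<in> V. h v div ?q = i}"
        using assms(1) by (intro card_image_le) auto
      finally show ?thesis by simp
    qed simp
  qed
qed

lemma edist_eq_iff_sqd_eq:
  "edist d (p u) (p v) = edist d (q u) (q v) \<longleftrightarrow> sqd d (\<lambda>(v, i). p v i) u v = sqd d (\<lambda>(v, i). q v i) u v"
  by (simp add: edist_def L2_set_def sqd_def)

lemma expander_rigid_core:
  fixes C :: real
  assumes G: "pair_graph G" and exp: "expander C G" and C: "8 * real d \<le> C" and d: "0 < d"
    and \<kappa>: "\<kappa> = real (card (pverts G)) / (2 * C)" "1 \<le> \<kappa>"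
  obtains W c where "W \<subseteq> pverts G" "10 * real d * \<kappa> \<le> card W"
    "\<And>u. (\<And>v w. v \<in> W \<Longrightarrow> w \<in> W \<Longrightarrow> (v, w) \<in> parcs G \<Longrightarrow>
        ip (W \<times> {..<d}) (edge_row (clustered c) (v, w)) u = 0) \<Longrightarrow> trivial_motion d W (clustered c) u"
proof -
  interpret pair_graph G by (rule G)
  have finV: "finite (pverts G)" by simp
  obtain c :: "'a \<Rightarrow> nat" where c: "\<And>i. i < 2 * d \<Longrightarrow> card (pverts G) div (2 * d) \<le> card {v \<in> pverts G. c v = i}"
    using balanced_colouring[OF finV, of "2 * d"] d by auto
  \<comment> \<open>From \<open>n = 2 * C * \<kappa> \<ge> 16 * d * \<kappa>\<close> the exact
    quotient is at least \<open>8 * \<kappa>\<close>, and rounding down costs less than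
    \<open>1 \<le> \<kappa>\<close>.\<close>
  have size: "7 * \<kappa> \<le> real (card (pverts G) div (2 * d))"
  proof -
    let ?n = "card (pverts G)" and ?q = "card (pverts G) div (2 * d)"
    have "?n = ?q * (2 * d) + ?n mod (2 * d)" by (rule div_mult_mod_eq[symmetric])
    also have "\<dots> < (?q + 1) * (2 * d)" using d by simp
    finally have "real ?n < real ((?q + 1) * (2 * d))" by (simp only: of_nat_less_iff)
    then have n: "real ?n < (real ?q + 1) * (2 * d)" by (simp add: algebra_simps)
    have "real ?n = 2 * C * \<kappa>" using C d by (simp add: \<kappa>(1))
    moreover have "16 * real d * \<kappa> \<le> 2 * C * \<kappa>" using C \<kappa>(2) by (intro mult_right_mono) auto
    ultimately have "(8 * \<kappa>) * (2 * d) < (real ?q + 1) * (2 * d)" using n by (simp add: algebra_simps)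
    then have "8 * \<kappa> < real ?q + 1" using d by simp
    then show ?thesis using \<kappa>(2) by simp
  qed
  \<comment> \<open>Discards the leftover vertices whose colour is out of range; the classes of
    colour below \<open>2 * d\<close> are unchanged.\<close>
  define V where "V = {v \<in> pverts G. c v < 2 * d}"
  have VG: "V \<subseteq> pverts G" by (auto simp: V_def)
  have cls: "{v \<in> V. c v = i} = {v \<in> pverts G. c v = i}" if "i < 2 * d" for i
    using that by (auto simp: V_def)
  interpret coloured_joined V "parcs G" c d \<kappa>
  proof
    show "finite V" by (rule finite_subset[OF VG finV])
    show "7 * \<kappa> \<le> card {v \<in> V. c v = i}" if "i < 2 * d" for i
      using c[OF that] size unfolding cls[OF that] by linarith
    show "(w, v) \<in> parcs G" if "(v, w) \<in> parcs G" for v w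
      using that by (rule arcs_symmetric)
    show "\<exists>a\<in>A. \<exists>b\<in>B. (a, b) \<in> parcs G"
      if "A \<subseteq> V" "B \<subseteq> V" "A \<inter> B = {}" "\<kappa> \<le> card A" "\<kappa> \<le> card B" for A B
      using conjunct2[OF exp[unfolded expander_def], rule_format, of A B] that VG
      unfolding \<kappa>(1) by simp
  qed (use d \<kappa>(2) in \<open>auto simp: V_def\<close>)
  obtain W T where adm: "admissible W T" and min: "\<And>W' T'. admissible W' T' \<Longrightarrow> weight W T \<le> weight W' T'"
    by (rule exists_minimal) (rule that)
  note WV = W[OF adm]
  show thesis
  proof (rule that[of W c])
    show "W \<subseteq> pverts G" using WV VG by (rule subset_trans)
    \<comment> \<open>Summing over the \<open>2 * d\<close> classes, each with more than
      \<open>5 * \<kappa>\<close> vertices, yields the bound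
      \<open>10 * d * \<kappa>\<close>.\<close>
    have "card W = (\<Sum>v\<in>W. card {i \<in> {..<2 * d}. c v = i})"
    proof -
      have "{i \<in> {..<2 * d}. c v = i} = {c v}" if "v \<in> W" for v
        using that WV by (auto simp: V_def)
      then show ?thesis by simp
    qed
    also have "\<dots> = (\<Sum>i<2 * d. card {v \<in> W. c v = i})"
      by (rule sum_card_swap) (use finW[OF adm] in auto)
    finally have "real (card W) = (\<Sum>i<2 * d. real (card {v \<in> W. c v = i}))" by simp
    also have "\<dots> \<ge> (\<Sum>i<2 * d. 5 * \<kappa>)"
      by (intro sum_mono less_imp_le card_class[OF adm]) simp
    finally show "10 * real d * \<kappa> \<le> card W" by simp
    show "trivial_motion d W (clustered c) u"
      if "\<And>v w. v \<in> W \<Longrightarrow> w \<in> W \<Longrightarrow> (v, w) \<in> parcs G \<Longrightarrow>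
        ip (W \<times> {..<d}) (edge_row (clustered c) (v, w)) u = 0" for u
    proof (rule clustered_framework_motions_trivial[OF d finW[OF adm], of c T "parcs G"])
      show "c v < 2 * d" if "v \<in> W" for v using that WV by (auto simp: V_def)
      show "T i j \<subseteq> {v \<in> W. c v = i}" if "i < 2 * d" "j < 2 * d" "i \<noteq> j" for i j
        by (rule T(1)[OF adm that])
      show "\<exists>a. \<forall>v\<in>T i j \<union> T j i. \<phi> v = a"
        if "i < 2 * d" "j < 2 * d" "i \<noteq> j" "\<And>v w. v \<in> T i j \<Longrightarrow> w \<in> T j i \<Longrightarrow> (v, w) \<in> parcs G \<Longrightarrow> \<phi> v = \<phi> w"
        for i j and \<phi> :: "'a \<Rightarrow> real"
        by (rule T_connected[OF adm min that])
      show "d \<le> card {j. j < 2 * d \<and> j \<noteq> c v \<and> v \<in> T (c v) j}" if "v \<in> W" for v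
        by (rule T_many[OF adm min that])
      show "\<exists>v\<in>T i j. 2 * card {j. j < 2 * d \<and> j \<noteq> i \<and> v \<notin> T i j} < d" if "i < 2 * d" "j < 2 * d" "i \<noteq> j" for i j
        by (rule excellent_exists[OF adm that])
    qed (rule that)
  qed
qed

text \<open>On the core, \<open>u\<close> agrees with a trivial motion, which extends to a trivial
  motion \<open>t\<close> of the whole graph. Let \<open>Z\<close> be the set where \<open>u\<close>
  and \<open>t\<close> agree. At a vertex with \<open>d\<close> neighbours in \<open>Z\<close>, the
  difference is orthogonal to \<open>d\<close> independent directions, so the vertex is itself in
  \<open>Z\<close>; expansion then leaves nothing outside \<open>Z\<close>.\<close>

lemma expander_generic_motions_trivial:
  fixes C :: real
  assumes G: "pair_graph G" and exp: "expander C G" and C: "8 * real d \<le> C" and d: "0 < d"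
    and \<kappa>: "1 \<le> real (card (pverts G)) / (2 * C)"
    and gen: "alg_independent (pverts G \<times> {..<d}) y"
    and u: "\<And>e. e \<in> parcs G \<Longrightarrow> ip (pverts G \<times> {..<d}) (edge_row y e) u = 0"
  shows "trivial_motion d (pverts G) y u"
proof -
  let ?V = "pverts G" and ?E = "parcs G"
  interpret pair_graph G by (rule G)
  have finV: "finite ?V" by simp
  define \<kappa> where "\<kappa> = real (card ?V) / (2 * C)"
  have \<kappa>1: "1 \<le> \<kappa>" using \<kappa> by (simp add: \<kappa>_def)
  obtain W c where W: "W \<subseteq> ?V" "10 * real d * \<kappa> \<le> card W"
    and core: "\<And>u. (\<And>v w. v \<in> W \<Longrightarrow> w \<in> W \<Longrightarrow> (v, w) \<in> ?E \<Longrightarrow>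
        ip (W \<times> {..<d}) (edge_row (clustered c) (v, w)) u = 0) \<Longrightarrow> trivial_motion d W (clustered c) u"
    using expander_rigid_core[OF G exp C d \<kappa>_def \<kappa>1] by metis
  have finW: "finite W" by (rule finite_subset[OF W(1) finV])
  have "trivial_motion d W y u"
  proof (rule generic_motions_trivial[OF finW, of "?E \<inter> W \<times> W" d y "clustered c"])
    show "alg_independent (W \<times> {..<d}) y" by (rule alg_independent_subset[OF gen]) (use W(1) in auto)
    show "trivial_motion d W (clustered c) x"
      if "\<And>e. e \<in> ?E \<inter> W \<times> W \<Longrightarrow> ip (W \<times> {..<d}) (edge_row (clustered c) e) x = 0" for x
      by (rule core) (use that in auto)
    show "ip (W \<times> {..<d}) (edge_row y e) u = 0" if eW: "e \<in> ?E \<inter> W \<times> W" for e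
    proof -
      obtain v w where e: "e = (v, w)" "v \<in> W" "w \<in> W" "(v, w) \<in> ?E" using eW by (cases e) auto
      have "v \<in> ?V" "w \<in> ?V" using e(2,3) W(1) by auto
      then show ?thesis
        using u[OF e(4)] ip_edge_row[OF finV, of v w d y u] ip_edge_row[OF finW e(2,3), of d y u] e(1) by simp
    qed
  qed auto
  then obtain A b where A: "skew d A" "\<And>v i. v \<in> W \<Longrightarrow> i < d \<Longrightarrow> u (v, i) = affine_skew d A b (\<lambda>k. y (v, k)) i"
    unfolding trivial_motion_def by auto
  define t where "t = (\<lambda>(v, i). affine_skew d A b (\<lambda>k. y (v, k)) i)"
  have t: "trivial_motion d ?V y t" unfolding trivial_motion_def t_def using A(1) by auto
  define Z where "Z = {v \<in> ?V. \<forall>i<d. u (v, i) = t (v, i)}"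
  have WZ: "W \<subseteq> Z" using W(1) A(2) by (auto simp: Z_def t_def)
  have finZ: "finite Z" using finV by (simp add: Z_def)
  have "Z = ?V"
  proof (rule expander_exhausted[OF G exp C d _ \<kappa>_def \<kappa>1])
    show "Z \<subseteq> ?V" by (auto simp: Z_def)
    have "card W \<le> card Z" by (rule card_mono[OF finZ WZ])
    then show "10 * real d * \<kappa> \<le> card Z" using W(2) by linarith
    fix v assume v: "v \<in> ?V - Z"
    show "card {w \<in> Z. (v, w) \<in> ?E} < d"
    proof (rule ccontr)
      assume "\<not> ?thesis"
      then obtain S where S: "S \<subseteq> {w \<in> Z. (v, w) \<in> ?E}" "card S = d" "finite S"
        by (meson not_less obtain_subset_with_card_n)
      have "\<forall>i<d. u (v, i) - t (v, i) = 0"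
      proof (rule generic_general_position[OF gen _ S(3,2)])
        show "S \<subseteq> ?V" "v \<in> ?V" "v \<notin> S" using S(1) v by (auto simp: Z_def)
        show "(\<Sum>i<d. (y (v, i) - y (w, i)) * (u (v, i) - t (v, i))) = 0" if "w \<in> S" for w
        proof -
          have w: "w \<in> ?V" "(v, w) \<in> ?E" "\<And>i. i < d \<Longrightarrow> u (w, i) = t (w, i)"
            using that S(1) by (auto simp: Z_def)
          have "ip (?V \<times> {..<d}) (edge_row y (v, w)) (\<lambda>x. u x - t x) = 0"
            unfolding ip_diff_right using u[OF w(2)] trivial_motion_edge[OF t finV _ w(1), of v] v by simp
          then show ?thesis using v w(1) ip_edge_row[OF finV, of v w d y "\<lambda>x. u x - t x"]
            by (simp add: w(3))
        qed
      qed
      then show False using v by (auto simp: Z_def)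
    qed
  qed
  then have "\<forall>v\<in>?V. \<forall>i<d. u (v, i) = t (v, i)" by (auto simp: Z_def)
  then show ?thesis using A(1) unfolding trivial_motion_def t_def by auto
qed

theorem theorem1p2:
  fixes C :: real and n :: nat and G :: "'a pair_pre_digraph"
  assumes "C \<ge> 8"
    and "real n \<ge> 9 * C"
    and "pair_graph G"
    and "card (pverts G) = n"
    and "expander C G"
  shows "d_rigid (nat \<lfloor>C / 8\<rfloor>) G"
proof -
  let ?d = "nat \<lfloor>C / 8\<rfloor>" and ?V = "pverts G" and ?E = "parcs G"
  interpret pair_graph G by (rule assms(3))
  have finV: "finite ?V" by simp
  have EV: "?E \<subseteq> ?V \<times> ?V" using in_arcsD1 in_arcsD2 by auto
  have C: "8 * real ?d \<le> C" and d: "0 < ?d" using assms(1) by linarith+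
  \<comment> \<open>The bound \<open>n \<ge> 9 * C\<close> gives
    \<open>n / (2 * C) \<ge> 9 / 2\<close>, so that rounding errors below 1 are absorbed by
    multiples of \<kappa>.\<close>
  have \<kappa>: "1 \<le> real (card ?V) / (2 * C)" using assms(1,2,4) by (simp add: field_simps)
  show ?thesis unfolding d_rigid_def
  proof (intro disjI2 allI impI)
    fix p assume "generic ?d ?V p"
    then have gen: "alg_independent (?V \<times> {..<?d}) (\<lambda>(v, i). p v i)" by (simp add: generic_def)
    show "rigid_framework ?d G p"
      unfolding rigid_framework_def
    proof (intro allI impI ballI)
      fix \<gamma> :: "real \<Rightarrow> 'a \<Rightarrow> nat \<Rightarrow> real" and t :: real and u v
      assume mot: "motion ?d ?V p \<gamma>"
        and edges: "\<forall>t\<in>{0..1}. \<forall>(u, v)\<in>?E. edist ?d (\<gamma> t u) (\<gamma> t v) = edist ?d (p u) (p v)"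
        and t: "t \<in> {0..1}" and uv: "u \<in> ?V" "v \<in> ?V"
      have "sqd ?d (\<lambda>(v, i). \<gamma> t v i) u v = sqd ?d (\<lambda>(v, i). p v i) u v"
      proof (rule generic_infinitesimally_rigid_imp_rigid[OF finV EV gen _ _ _ _ t uv, where \<gamma> = "\<lambda>t (v, i). \<gamma> t v i"])
        show "ip (?V \<times> {..<?d}) (edge_row (\<lambda>(v, i). p v i) e) x = 0"
          if "\<And>e. e \<in> ?E \<Longrightarrow> ip (?V \<times> {..<?d}) (edge_row (\<lambda>(v, i). p v i) e) x = 0" "e \<in> ?V \<times> ?V" for x e
        proof -
          have "trivial_motion ?d ?V (\<lambda>(v, i). p v i) x"
            by (rule expander_generic_motions_trivial[OF assms(3,5) C d \<kappa> gen that(1)])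
          then show ?thesis using trivial_motion_edge[OF _ finV] that(2) by (cases e) auto
        qed
        show "continuous_on {0..1} (\<lambda>t. (\<lambda>(v, i). \<gamma> t v i) x)" if "x \<in> ?V \<times> {..<?d}" for x
          using mot that by (cases x) (auto simp: motion_def)
        show "(\<lambda>(v, i). \<gamma> 0 v i) x = (\<lambda>(v, i). p v i) x" if "x \<in> ?V \<times> {..<?d}" for x
          using mot that by (cases x) (auto simp: motion_def)
        show "sqd ?d (\<lambda>(v, i). \<gamma> t v i) v w = sqd ?d (\<lambda>(v, i). p v i) v w" if "t \<in> {0..1}" "(v, w) \<in> ?E" for t v w
          using edges that by (auto simp flip: edist_eq_iff_sqd_eq)
      qed
      then show "edist ?d (\<gamma> t u) (\<gamma> t v) = edist ?d (p u) (p v)" by (simp add: edist_eq_iff_sqd_eq)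
    qed
  qed
qed

end
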